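(* Consider a multistage stochastic program on a scenario tree with the regularization, standing assumptions and nested decomposition algorithm described in the context. Let $\epsilon>0$ and choose values $\delta_n>0$ for every non-leaf node $n$ such that $\sum_{n\in\mathcal N,\,\mathcal C(n)\neq\varnothing}p_n\delta_n=\epsilon$. Let $\{\mathcal B_{n,k}\subset\mathbb R^{d_n}\}_{1\le k\le K_n,\,n\in\mathcal N}$ be a collection of balls (in the norm $\|\cdot\|$), $\mathcal B_{n,k}$ having diameter $D_{n,k}\ge 0$, such that $\mathcal X_n\subseteq\bigcup_{k=1}^{K_n}\mathcal B_{n,k}$ for every $n\in\mathcal N$. Put $L_n:=\sum_{m\in\mathcal C(n)}p_{nm}(l_{m,\lambda}+l_{m,\rho})$. If the nested decomposition algorithm with tolerance $\epsilon$ terminates with an $\epsilon$-optimal root node solution $(x_r^*,y_r^* )$ at the end of the $i$-th iteration, then $$i\le\sum_{n\in\mathcal N,\ \mathcal C(n)\neq\varnothing}\ \sum_{k=1}^{K_n}\left(1+\frac{2L_nD_{n,k}}{\delta_n}\right)^{d_n}.$$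
   Context: **Problem.** $\mathcal N$ is the node set of a finite rooted scenario tree with root $r$; node $n$ is in stage $t(n)$, $t(r)=0$, the last stage is $T\ge1$, and the leaves are exactly the stage-$T$ nodes. $a(n)$ is the parent and $\mathcal C(n)$ the set of children of $n$. $p_n>0$ is the probability of node $n$, $p_r=1$, $p_{nm}=p_m/p_n$ for $m\in\mathcal C(n)$, and $\sum_{m\in\mathcal C(n)}p_{nm}=1$ for non-leaf $n$. For each $n$, $\mathcal F_n$ is a compact set of pairs $(x_n,y_n)$ in a Euclidean space, $\mathcal X_n\subset\mathbb R^{d_n}$ is its projection onto the $x_n$-coordinates; $x_{a(r)}=0$, $\mathcal X_{a(r)}=\{0\}$. The cost $f_n(z,y,x)\in[0,+\infty]$ is defined for $z\in\mathcal X_{a(n)}$, $(x,y)\in\mathcal F_n$, and is lower semicontinuous. There exist $(x_n,y_n)\in\mathcal F_n$, $n\in\mathcal N$, with $\sum_n p_nf_n(x_{a(n)},y_n,x_n)<+\infty$. The original problem is $v^{\mathrm{prim}}=\min\{\sum_{n}p_nf_n(x_{a(n)},y_n,x_n):(x_n,y_n)\in\mathcal F_n\ \forall n\}$. Fix a norm $\|\cdot\|$ with dual norm $\|\cdot\|_*$. **Regularization.** A penalty function is $\psi:\mathbb R^d\to\mathbb R_+$ with $\psi(x)=0$ iff $x=0$ and with the diameter of $\{\psi\le a\}$ tending to $0$ as $a\to0$. For each $n$ a penalty function $\psi_n$, 1-Lipschitz on $\mathcal X_{a(n)}-\mathcal X_{a(n)}$, and $\sigma_n>0$ are given. Recursively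 from the leaves, with $\mathcal Q_n^{\mathrm R}(x)=\sum_{m\in\mathcal C(n)}p_{nm}Q_m^{\mathrm R}(x)$ (zero at leaves), $$Q_n^{\mathrm R}(x_{a(n)})=\min_{(x,y)\in\mathcal F_n,\ z\in\mathcal X_{a(n)}}\{f_n(z,y,x)+\sigma_n\psi_n(x_{a(n)}-z)+\mathcal Q_n^{\mathrm R}(x)\}.$$ $v^{\mathrm{reg}}=\min_{(x,y)\in\mathcal F_r}\{f_r(x_{a(r)},y,x)+\mathcal Q_r^{\mathrm R}(x)\}$, and $(x_r,y_r)\in\mathcal F_r$ is an $\epsilon$-optimal root node solution if $f_r(x_{a(r)},y_r,x_r)+\mathcal Q_r^{\mathrm R}(x_r)\le v^{\mathrm{reg}}+\epsilon$. Standing assumption (exactness): every optimal solution of $\min\{\sum_n p_n(f_n(z_n,y_n,x_n)+\sigma_n\psi_n(x_{a(n)}-z_n)):(x_n,y_n)\in\mathcal F_n,\ z_n\in\mathcal X_{a(n)}\}$ satisfies $z_n=x_{a(n)}$ for all $n$. The problem is called convex if all $\mathcal F_n$, $f_n$ and $\psi_n$ are convex. For $n\ne r$ let $\mathcal U_n=\{(\lambda,\rho):\|\lambda\|_*\le l_{n,\lambda},\ 0\le\rho\le l_{n,\rho}\}$ with given nonnegative bounds satisfying $l_{n,\lambda}\ge\sigma_n,\ l_{n,\rho}=0$ in the convex case with $\psi_n=\|\cdot\|$, and $l_{n,\rho}\ge\sigma_n$ otherwise. **Nested decomposition algorithm with tolerance $\epsilon$.** "An optimal solution" below means any optimal solution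 returned by a given oracle. Initialize $\underline{\mathcal Q}_n^0\equiv0$ for all $n$, $\overline{\mathcal Q}_n^0\equiv+\infty$ for non-leaf $n$; for leaves $\underline{\mathcal Q}_n^i\equiv\overline{\mathcal Q}_n^i\equiv0$ for all $i$. Let $(x_r^1,y_r^1)$ be an optimal solution of $\min_{(x,y)\in\mathcal F_r}f_r(x_{a(r)},y,x)$, $\mathrm{LB}=f_r(x_{a(r)},y_r^1,x_r^1)$, $\mathrm{UB}=+\infty$. For $i=1,2,\dots$, while $\mathrm{UB}-\mathrm{LB}>\epsilon$, iteration $i$ is: (Forward) for stages $1,2,\dots,T$ and each node $n$ in the stage, $(x_n^i,y_n^i,z_n^i)$ is an optimal solution of $\min_{(x,y)\in\mathcal F_n,z\in\mathcal X_{a(n)}}\{f_n(z,y,x)+\sigma_n\psi_n(x^i_{a(n)}-z)+\underline{\mathcal Q}_n^{i-1}(x)\}$. (Backward) for stages $T,\dots,1$ and each node $n$ in the stage: if $n$ is not a leaf, set $\underline{\mathcal Q}_n^i(x)=\max\{\underline{\mathcal Q}_n^{i-1}(x),\sum_{m\in\mathcal C(n)}p_{nm}C_m^i(x)\}$ and let $\overline{\mathcal Q}_n^i(x)$ be $\mathrm{conv}\{\overline{\mathcal Q}_n^{i-1},h_n^i\}(x)$ in the convex case and $\min\{\overline{\mathcal Q}_n^{i-1}(x),h_n^i(x)\}$ otherwise, where $h_n^i(x)=\sum_{m\in\mathcal C(n)}p_{nm}(\bar v_m^i+\sigma_m\|x-x_n^i\|)$ and $\mathrm{conv}\{f,g\}$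 is the convex biconjugate of $\min\{f,g\}$ on $\mathbb R^{d_n}$. Then let $\underline v_n^i$ be the optimal value, and $(\hat\lambda_n^i,\hat\rho_n^i)$ an optimal outer solution, of $\max_{(\lambda,\rho)\in\mathcal U_n}\min_{(x,y)\in\mathcal F_n,z\in\mathcal X_{a(n)}}\{f_n(z,y,x)+\langle\lambda,x_{a(n)}^i-z\rangle+\rho\psi_n(x_{a(n)}^i-z)+\underline{\mathcal Q}_n^i(x)\}$; set $C_n^i(x)=-\langle\hat\lambda_n^i,x_{a(n)}^i-x\rangle-\hat\rho_n^i\psi_n(x_{a(n)}^i-x)+\underline v_n^i$ and $\bar v_n^i=f_n(z_n^i,y_n^i,x_n^i)+\sigma_n\psi_n(x_{a(n)}^i-z_n^i)+\overline{\mathcal Q}_n^i(x_n^i)$. (Root) update $\underline{\mathcal Q}_r^i,\overline{\mathcal Q}_r^i$ by the same formulas; let $(x_r^{i+1},y_r^{i+1})$ be an optimal solution of $\min_{(x,y)\in\mathcal F_r}\{f_r(x_{a(r)},y,x)+\underline{\mathcal Q}_r^i(x)\}$; set $\mathrm{LB}=f_r(x_{a(r)},y_r^{i+1},x_r^{i+1})+\underline{\mathcal Q}_r^i(x_r^{i+1})$; if $\mathrm{UB}>f_r(x_{a(r)},y_r^{i+1},x_r^{i+1})+\overline{\mathcal Q}_r^i(x_r^{i+1})$, set $\mathrm{UB}$ to this value and $(x_r^*,y_r^* )=(x_r^{i+1},y_r^{i+1})$. *)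

theory Defs
  imports "HOL-Analysis.Analysis"
begin

text \<open>
  The spaces \<open>R^{d_n}\<close> have node-dependent dimensions. They are realised as linear subspaces
  \<open>xspace P n\<close> of one ambient Euclidean space \<open>'a\<close>, so that \<open>d_n\<close> is \<open>dim (xspace P n)\<close>; the inner
  product is the inherited one, while the norm of \<open>R^{d_n}\<close> is an arbitrary norm \<open>nrm P n\<close> on
  that subspace. The vectors \<open>y_n\<close> of all nodes live in a common Euclidean space \<open>'b\<close>.
\<close>

definition norm_on :: "'a::real_vector set \<Rightarrow> ('a \<Rightarrow> real) \<Rightarrow> bool" where
  "norm_on E \<nu> \<longleftrightarrow>
     (\<forall>x\<in>E. 0 \<le> \<nu> x \<and> (\<nu> x = 0 \<longleftrightarrow> x = 0)) \<and>
     (\<forall>x\<in>E. \<forall>c. \<nu> (c *\<^sub>R x) = \<bar>c\<bar> * \<nu> x) \<and>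
     (\<forall>x\<in>E. \<forall>y\<in>E. \<nu> (x + y) \<le> \<nu> x + \<nu> y)"

definition dual_norm :: "'a::real_inner set \<Rightarrow> ('a \<Rightarrow> real) \<Rightarrow> 'a \<Rightarrow> real" where
  "dual_norm E \<nu> l = (SUP x\<in>{x\<in>E. \<nu> x \<le> 1}. l \<bullet> x)"

text \<open>Open and closed balls are both admitted; the radius is half of the diameter \<open>D\<close>.\<close>

definition is_ball :: "'a::real_vector set \<Rightarrow> ('a \<Rightarrow> real) \<Rightarrow> real \<Rightarrow> 'a set \<Rightarrow> bool" where
  "is_ball E \<nu> D B \<longleftrightarrow>
     (\<exists>c\<in>E. B = {x\<in>E. \<nu> (x - c) \<le> D / 2} \<or> B = {x\<in>E. \<nu> (x - c) < D / 2})"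

text \<open>An extended-real diameter is used because the library constant \<open>diameter\<close> is
  meaningless for unbounded sets.\<close>

definition ediameter :: "('a::real_vector \<Rightarrow> real) \<Rightarrow> 'a set \<Rightarrow> ereal" where
  "ediameter \<nu> S = (SUP (x, y)\<in>S \<times> S. ereal (\<nu> (x - y)))"

definition lsc_on :: "'a::topological_space set \<Rightarrow> ('a \<Rightarrow> ereal) \<Rightarrow> bool" where
  "lsc_on S g \<longleftrightarrow> (\<forall>u\<in>S. g u \<le> Liminf (at u within S) g)"

definition econvex_on :: "'a::real_vector set \<Rightarrow> ('a \<Rightarrow> ereal) \<Rightarrow> bool" where
  "econvex_on S g \<longleftrightarrow> convex S \<and>
     (\<forall>u\<in>S. \<forall>v\<in>S. \<forall>c\<in>{0..1}. g ((1 - c) *\<^sub>R u + c *\<^sub>R v) \<le> ereal (1 - c) * g u + ereal c * g v)"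

definition conjugate_on :: "'a::real_inner set \<Rightarrow> ('a \<Rightarrow> ereal) \<Rightarrow> 'a \<Rightarrow> ereal" where
  "conjugate_on E g l = (SUP x\<in>E. ereal (l \<bullet> x) - g x)"

definition biconjugate_on :: "'a::real_inner set \<Rightarrow> ('a \<Rightarrow> ereal) \<Rightarrow> 'a \<Rightarrow> ereal" where
  "biconjugate_on E g = conjugate_on E (conjugate_on E g)"

definition penalty_on :: "'a::real_vector set \<Rightarrow> ('a \<Rightarrow> real) \<Rightarrow> ('a \<Rightarrow> real) \<Rightarrow> bool" where
  "penalty_on E \<nu> \<psi> \<longleftrightarrow>
     (\<forall>x\<in>E. 0 \<le> \<psi> x \<and> (\<psi> x = 0 \<longleftrightarrow> x = 0)) \<and>
     ((\<lambda>a. ediameter \<nu> {x\<in>E. \<psi> x \<le> a}) \<longlongrightarrow> 0) (at_right 0)"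

definition lipschitz1_on :: "'a::real_vector set \<Rightarrow> ('a \<Rightarrow> real) \<Rightarrow> ('a \<Rightarrow> real) \<Rightarrow> bool" where
  "lipschitz1_on S \<nu> g \<longleftrightarrow> (\<forall>u\<in>S. \<forall>v\<in>S. \<bar>g u - g v\<bar> \<le> \<nu> (u - v))"

text \<open>As \<open>x_{a(r)}\<close> and \<open>X_{a(r)}\<close> are used, the parent of the root is an index outside the node
  set. The cost \<open>cost P n z y x\<close> is \<open>f_n(z,y,x)\<close>, and \<open>lbnd\<close>, \<open>rbnd\<close> are \<open>l_{n,\<lambda>}\<close>, \<open>l_{n,\<rho>}\<close>.\<close>

record ('n, 'a, 'b) problem =
  nodes :: "'n set"
  root :: 'n
  horizon :: nat
  stage :: "'n \<Rightarrow> nat"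
  parent :: "'n \<Rightarrow> 'n"
  prob :: "'n \<Rightarrow> real"
  xspace :: "'n \<Rightarrow> 'a set"
  nrm :: "'n \<Rightarrow> 'a \<Rightarrow> real"
  feas :: "'n \<Rightarrow> ('a \<times> 'b) set"
  cost :: "'n \<Rightarrow> 'a \<Rightarrow> 'b \<Rightarrow> 'a \<Rightarrow> ereal"
  pen :: "'n \<Rightarrow> 'a \<Rightarrow> real"
  sig :: "'n \<Rightarrow> real"
  lbnd :: "'n \<Rightarrow> real"
  rbnd :: "'n \<Rightarrow> real"

definition children :: "('n, 'a, 'b) problem \<Rightarrow> 'n \<Rightarrow> 'n set" where
  "children P n = {m \<in> nodes P. parent P m = n}"

definition nonleaves :: "('n, 'a, 'b) problem \<Rightarrow> 'n set" where
  "nonleaves P = {n \<in> nodes P. children P n \<noteq> {}}"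

definition cprob :: "('n, 'a, 'b) problem \<Rightarrow> 'n \<Rightarrow> 'n \<Rightarrow> real" where
  "cprob P n m = prob P m / prob P n"

definition xset :: "('n, 'a::zero, 'b) problem \<Rightarrow> 'n \<Rightarrow> 'a set" where
  "xset P n = (if n = parent P (root P) then {0} else fst ` feas P n)"

definition scenario_tree :: "('n, 'a, 'b) problem \<Rightarrow> bool" where
  "scenario_tree P \<longleftrightarrow>
     finite (nodes P) \<and> root P \<in> nodes P \<and> parent P (root P) \<notin> nodes P \<and>
     stage P (root P) = 0 \<and> 1 \<le> horizon P \<and>
     (\<forall>n\<in>nodes P - {root P}. parent P n \<in> nodes P \<and> stage P n = Suc (stage P (parent P n))) \<and>
     (\<forall>n\<in>nodes P. stage P n \<le> horizon P \<and> (children P n = {} \<longleftrightarrow> stage P n = horizon P)) \<and>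
     (\<forall>n\<in>nodes P. 0 < prob P n) \<and> prob P (root P) = 1 \<and>
     (\<forall>n\<in>nonleaves P. (\<Sum>m\<in>children P n. cprob P n m) = 1)"

definition regular_data :: "('n, 'a::euclidean_space, 'b::euclidean_space) problem \<Rightarrow> bool" where
  "regular_data P \<longleftrightarrow>
     (\<forall>n\<in>insert (parent P (root P)) (nodes P).
        subspace (xspace P n) \<and> norm_on (xspace P n) (nrm P n)) \<and>
     (\<forall>n\<in>nodes P.
        compact (feas P n) \<and> fst ` feas P n \<subseteq> xspace P n \<and>
        (\<forall>z\<in>xset P (parent P n). \<forall>(x, y)\<in>feas P n. 0 \<le> cost P n z y x) \<and>
        lsc_on (xset P (parent P n) \<times> feas P n) (\<lambda>(z, x, y). cost P n z y x)) \<and>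
     (\<exists>x y. x (parent P (root P)) = 0 \<and> (\<forall>n\<in>nodes P. (x n, y n) \<in> feas P n) \<and>
        (\<Sum>n\<in>nodes P. ereal (prob P n) * cost P n (x (parent P n)) (y n) (x n)) < \<infinity>)"

definition regularization :: "('n, 'a::euclidean_space, 'b) problem \<Rightarrow> bool" where
  "regularization P \<longleftrightarrow>
     (\<forall>n\<in>nodes P. let a = parent P n in
        penalty_on (xspace P a) (nrm P a) (pen P n) \<and>
        lipschitz1_on {x - z | x z. x \<in> xset P a \<and> z \<in> xset P a} (nrm P a) (pen P n) \<and>
        0 < sig P n)"

definition reg_cost ::
  "('n, 'a::real_vector, 'b) problem \<Rightarrow> 'n \<Rightarrow> 'a \<Rightarrow> 'a \<Rightarrow> 'b \<Rightarrow> 'a \<Rightarrow> ereal" where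
  "reg_cost P n xa z y x = cost P n z y x + ereal (sig P n * pen P n (xa - z))"

definition node_feas :: "('n, 'a::zero, 'b) problem \<Rightarrow> 'n \<Rightarrow> ('a \<times> 'b \<times> 'a) set" where
  "node_feas P n = {(x, y, z). (x, y) \<in> feas P n \<and> z \<in> xset P (parent P n)}"

definition exact_regularization :: "('n, 'a::real_vector, 'b) problem \<Rightarrow> bool" where
  "exact_regularization P \<longleftrightarrow>
     (\<forall>x y z.
        is_arg_min
          (\<lambda>(x, y, z). \<Sum>n\<in>nodes P.
             ereal (prob P n) * reg_cost P n (x (parent P n)) (z n) (y n) (x n))
          (\<lambda>(x, y, z). x (parent P (root P)) = 0 \<and> (\<forall>n\<in>nodes P. (x n, y n, z n) \<in> node_feas P n))
          (x, y, z) \<longrightarrow>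
        (\<forall>n\<in>nodes P. z n = x (parent P n)))"

definition convex_problem :: "('n, 'a::real_vector, 'b::real_vector) problem \<Rightarrow> bool" where
  "convex_problem P \<longleftrightarrow>
     (\<forall>n\<in>nodes P.
        convex (feas P n) \<and>
        econvex_on (xset P (parent P n) \<times> feas P n) (\<lambda>(z, x, y). cost P n z y x) \<and>
        convex_on (xspace P (parent P n)) (pen P n))"

text \<open>The case with \<open>l_{n,\<rho>} = 0\<close> is a property of the whole problem: all penalties entering the
  cuts are norms. A cut with positive \<open>\<rho>\<close> at one node would make the lower approximation at its
  parent nonconvex, and the bound \<open>l_{n,\<rho>} = 0\<close> would then no longer be justified there.\<close>

definition convex_norm_problem :: "('n, 'a::real_vector, 'b::real_vector) problem \<Rightarrow> bool" where
  "convex_norm_problem P \<longleftrightarrow>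
     convex_problem P \<and>
     (\<forall>n\<in>nodes P - {root P}. \<forall>x\<in>xspace P (parent P n). pen P n x = nrm P (parent P n) x)"

definition multiplier_bounds :: "('n, 'a::real_vector, 'b::real_vector) problem \<Rightarrow> bool" where
  "multiplier_bounds P \<longleftrightarrow>
     (\<forall>n\<in>nodes P - {root P}. 0 \<le> lbnd P n \<and> 0 \<le> rbnd P n \<and>
        (if convex_norm_problem P then sig P n \<le> lbnd P n \<and> rbnd P n = 0
         else sig P n \<le> rbnd P n))"

definition multipliers :: "('n, 'a::real_inner, 'b) problem \<Rightarrow> 'n \<Rightarrow> ('a \<times> real) set" where
  "multipliers P n =
     {(l, \<rho>). l \<in> xspace P (parent P n) \<and>
        dual_norm (xspace P (parent P n)) (nrm P (parent P n)) l \<le> lbnd P n \<and>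
        0 \<le> \<rho> \<and> \<rho> \<le> rbnd P n}"

text \<open>\<open>exp_ctg P k n\<close> is the expected cost-to-go function of a node \<open>n\<close> that is \<open>k\<close> stages above
  the leaves; the minima, which are attained, are written as infima.\<close>

primrec exp_ctg :: "('n, 'a::real_vector, 'b) problem \<Rightarrow> nat \<Rightarrow> 'n \<Rightarrow> 'a \<Rightarrow> ereal" where
  "exp_ctg P 0 n xa = 0"
| "exp_ctg P (Suc k) n xa =
     (\<Sum>m\<in>children P n. ereal (cprob P n m) *
        (INF (x, y, z)\<in>node_feas P m. reg_cost P m xa z y x + exp_ctg P k m x))"

definition ctgR :: "('n, 'a::real_vector, 'b) problem \<Rightarrow> 'n \<Rightarrow> 'a \<Rightarrow> ereal" where
  "ctgR P n = exp_ctg P (horizon P - stage P n) n"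

definition root_value :: "('n, 'a::real_vector, 'b) problem \<Rightarrow> ('a \<Rightarrow> ereal) \<Rightarrow> 'a \<times> 'b \<Rightarrow> ereal" where
  "root_value P Q = (\<lambda>(x, y). cost P (root P) 0 y x + Q x)"

definition vreg :: "('n, 'a::real_vector, 'b) problem \<Rightarrow> ereal" where
  "vreg P = (INF xy\<in>feas P (root P). root_value P (ctgR P (root P)) xy)"

definition eps_optimal_root :: "('n, 'a::real_vector, 'b) problem \<Rightarrow> real \<Rightarrow> 'a \<times> 'b \<Rightarrow> bool" where
  "eps_optimal_root P \<epsilon> xy \<longleftrightarrow>
     xy \<in> feas P (root P) \<and> root_value P (ctgR P (root P)) xy \<le> vreg P + ereal \<epsilon>"

text \<open>A run is the record of all quantities computed by the algorithm, the first argument being the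
  iteration (\<open>0\<close> for the initialization). The oracle is modelled by leaving the choice among optimal
  solutions open.\<close>

record ('n, 'a, 'b) run =
  xit :: "nat \<Rightarrow> 'n \<Rightarrow> 'a"
  yit :: "nat \<Rightarrow> 'n \<Rightarrow> 'b"
  zit :: "nat \<Rightarrow> 'n \<Rightarrow> 'a"
  lowQ :: "nat \<Rightarrow> 'n \<Rightarrow> 'a \<Rightarrow> ereal"
  upQ :: "nat \<Rightarrow> 'n \<Rightarrow> 'a \<Rightarrow> ereal"
  lowv :: "nat \<Rightarrow> 'n \<Rightarrow> ereal"
  upv :: "nat \<Rightarrow> 'n \<Rightarrow> ereal"
  lamit :: "nat \<Rightarrow> 'n \<Rightarrow> 'a"
  rhoit :: "nat \<Rightarrow> 'n \<Rightarrow> real"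
  LB :: "nat \<Rightarrow> ereal"
  UB :: "nat \<Rightarrow> ereal"
  incumbent :: "nat \<Rightarrow> 'a \<times> 'b"

definition dual_fun :: "('n, 'a::real_inner, 'b) problem \<Rightarrow> 'n \<Rightarrow> 'a \<Rightarrow> ('a \<Rightarrow> ereal) \<Rightarrow>
    'a \<times> real \<Rightarrow> ereal" where
  "dual_fun P n xa Q = (\<lambda>(l, \<rho>).
     INF (x, y, z)\<in>node_feas P n.
       cost P n z y x + ereal (l \<bullet> (xa - z) + \<rho> * pen P n (xa - z)) + Q x)"

definition cut :: "('n, 'a::real_inner, 'b) problem \<Rightarrow> ('n, 'a, 'b) run \<Rightarrow> nat \<Rightarrow> 'n \<Rightarrow> 'a \<Rightarrow> ereal" where
  "cut P R i n x =
     (let xa = xit R i (parent P n) in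
      ereal (- (lamit R i n \<bullet> (xa - x)) - rhoit R i n * pen P n (xa - x)) + lowv R i n)"

definition up_cone :: "('n, 'a::real_inner, 'b) problem \<Rightarrow> ('n, 'a, 'b) run \<Rightarrow> nat \<Rightarrow> 'n \<Rightarrow> 'a \<Rightarrow> ereal" where
  "up_cone P R i n x =
     (\<Sum>m\<in>children P n. ereal (cprob P n m) *
        (upv R i m + ereal (sig P m * nrm P n (x - xit R i n))))"

definition initialization :: "('n, 'a::real_inner, 'b) problem \<Rightarrow> ('n, 'a, 'b) run \<Rightarrow> bool" where
  "initialization P R \<longleftrightarrow>
     (\<forall>n\<in>nodes P. \<forall>x\<in>xspace P n. lowQ R 0 n x = 0) \<and>
     (\<forall>n\<in>nonleaves P. \<forall>x\<in>xspace P n. upQ R 0 n x = \<infinity>) \<and>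
     (\<forall>n\<in>nodes P - nonleaves P. \<forall>i. \<forall>x\<in>xspace P n. lowQ R i n x = 0 \<and> upQ R i n x = 0) \<and>
     is_arg_min (root_value P (\<lambda>x. 0)) (\<lambda>xy. xy \<in> feas P (root P))
       (xit R 1 (root P), yit R 1 (root P)) \<and>
     LB R 0 = root_value P (\<lambda>x. 0) (xit R 1 (root P), yit R 1 (root P)) \<and>
     UB R 0 = \<infinity>"

definition forward_step ::
  "('n, 'a::real_inner, 'b) problem \<Rightarrow> ('n, 'a, 'b) run \<Rightarrow> nat \<Rightarrow> bool" where
  "forward_step P R i \<longleftrightarrow>
     (\<forall>n\<in>nodes P - {root P}.
        is_arg_min
          (\<lambda>(x, y, z). reg_cost P n (xit R i (parent P n)) z y x + lowQ R (i - 1) n x)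
          (\<lambda>w. w \<in> node_feas P n)
          (xit R i n, yit R i n, zit R i n))"

text \<open>This includes the root, whose update uses the same formulas.\<close>

definition update_step ::
  "('n, 'a::real_inner, 'b::real_vector) problem \<Rightarrow> ('n, 'a, 'b) run \<Rightarrow> nat \<Rightarrow> bool" where
  "update_step P R i \<longleftrightarrow>
     (\<forall>n\<in>nonleaves P. \<forall>x\<in>xspace P n.
        lowQ R i n x =
          max (lowQ R (i - 1) n x) (\<Sum>m\<in>children P n. ereal (cprob P n m) * cut P R i m x) \<and>
        upQ R i n x =
          (if convex_problem P
           then biconjugate_on (xspace P n) (\<lambda>u. min (upQ R (i - 1) n u) (up_cone P R i n u)) x
           else min (upQ R (i - 1) n x) (up_cone P R i n x)))"

definition backward_step ::
  "('n, 'a::real_inner, 'b) problem \<Rightarrow> ('n, 'a, 'b) run \<Rightarrow> nat \<Rightarrow> bool" where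
  "backward_step P R i \<longleftrightarrow>
     (\<forall>n\<in>nodes P - {root P}. let xa = xit R i (parent P n) in
        lowv R i n = (SUP u\<in>multipliers P n. dual_fun P n xa (lowQ R i n) u) \<and>
        is_arg_max (dual_fun P n xa (lowQ R i n)) (\<lambda>u. u \<in> multipliers P n)
          (lamit R i n, rhoit R i n) \<and>
        upv R i n =
          reg_cost P n xa (zit R i n) (yit R i n) (xit R i n) + upQ R i n (xit R i n))"

definition root_step ::
  "('n, 'a::real_inner, 'b) problem \<Rightarrow> ('n, 'a, 'b) run \<Rightarrow> nat \<Rightarrow> bool" where
  "root_step P R i \<longleftrightarrow>
     (let r = root P;
          new = (xit R (Suc i) r, yit R (Suc i) r);
          ub = root_value P (upQ R i r) new
      in is_arg_min (root_value P (lowQ R i r)) (\<lambda>xy. xy \<in> feas P r) new \<and>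
         LB R i = root_value P (lowQ R i r) new \<and>
         UB R i = (if ub < UB R (i - 1) then ub else UB R (i - 1)) \<and>
         incumbent R i = (if ub < UB R (i - 1) then new else incumbent R (i - 1)))"

definition terminates_at ::
  "('n, 'a::real_inner, 'b::real_vector) problem \<Rightarrow> real \<Rightarrow> ('n, 'a, 'b) run \<Rightarrow> nat \<Rightarrow> bool" where
  "terminates_at P \<epsilon> R i \<longleftrightarrow>
     1 \<le> i \<and> initialization P R \<and>
     (\<forall>j\<in>{1..i}. ereal \<epsilon> < UB R (j - 1) - LB R (j - 1) \<and>
        forward_step P R j \<and> update_step P R j \<and> backward_step P R j \<and> root_step P R j) \<and>
     \<not> ereal \<epsilon> < UB R i - LB R i"

definition lip_const :: "('n, 'a, 'b) problem \<Rightarrow> 'n \<Rightarrow> real" where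
  "lip_const P n = (\<Sum>m\<in>children P n. cprob P n m * (lbnd P m + rbnd P m))"

end

(*
  Split the tolerance along the tree by thresholds gamma_n = delta_n + sum over children of
  p_nm * gamma_m, so that gamma_r = epsilon. While the algorithm runs, the gap between the upper and
  lower cost-to-go approximations at the root iterate exceeds gamma_r, and leaves have gap 0; a
  deepest node n whose gap exceeds gamma_n therefore has only children m with gap at most gamma_m.
  The update at such an n brings its gap at x below gamma_n - delta_n + 2 L_n ||x - x_n^j||, so two
  iterates of n at which this happens are more than delta_n / (2 L_n) apart. Comparing volumes
  bounds the number of such points in each ball, and every iteration is counted at some n.
*)

theory Submission
  imports Defs
begin

subsection \<open>Norms on subspaces\<close>

text \<open>The local estimate compares both approximations with the optimal value of the forward
  problem at a child m. If the old gap at the child's iterate is at most gamma_m, then the upper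
  value is at most that optimum plus gamma_m, while strong duality puts the new cut value at or
  above it. Duality comes from two sources. If l_rho >= sigma, the pair (0, sigma_m) is an
  admissible multiplier. If l_rho = 0, a vector of dual norm at most sigma_m has to be found by
  separating convex sets, so convexity of the lower approximations must be carried through the whole
  run. Away from the iterate the cone rises and the averaged cut falls, each at rate at most L_n;
  this is the factor 2 in 2 L_n. An estimate obtained at iteration j stays valid later because the
  approximations are monotone in the iteration.

  In the packing step r = D/2 and s = delta/(2L): disjoint balls of radius s/2 inside one of radius
  r + s/2 give the ratio 1 + 2r/s = 1 + 2LD/delta. The norm is arbitrary and given only on a
  subspace, so the volume argument must be arranged to produce the exponent d_n and not the ambient
  dimension.\<close>

lemma norm_on_zero: "subspace E \<Longrightarrow> norm_on E \<nu> \<Longrightarrow> \<nu> 0 = 0"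
  by (auto simp: norm_on_def subspace_0)

lemma norm_on_minus_commute:
  assumes "subspace E" "norm_on E \<nu>" "x \<in> E" "y \<in> E"
  shows "\<nu> (x - y) = \<nu> (y - x)"
proof -
  have "\<nu> ((-1) *\<^sub>R (y - x)) = \<bar>-1\<bar> * \<nu> (y - x)"
    using assms unfolding norm_on_def by (meson subspace_diff)
  then show ?thesis by simp
qed

lemma norm_on_triangle:
  assumes "subspace E" "norm_on E \<nu>" "x \<in> E" "y \<in> E" "z \<in> E"
  shows "\<nu> (x - z) \<le> \<nu> (x - y) + \<nu> (y - z)"
proof -
  have "\<nu> ((x - y) + (y - z)) \<le> \<nu> (x - y) + \<nu> (y - z)"
    using assms unfolding norm_on_def by (meson subspace_diff)
  then show ?thesis by simp
qed

lemma norm_on_sum_le: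
  assumes "subspace E" "norm_on E \<nu>" "finite S" "\<And>i. i \<in> S \<Longrightarrow> g i \<in> E"
  shows "\<nu> (sum g S) \<le> (\<Sum>i\<in>S. \<nu> (g i))"
  using assms(3,4)
proof (induction S rule: finite_induct)
  case empty
  then show ?case using norm_on_zero[OF assms(1,2)] by simp
next
  case (insert i S)
  have "\<nu> (g i + sum g S) \<le> \<nu> (g i) + \<nu> (sum g S)"
    using assms(1,2) insert.prems unfolding norm_on_def
    by (meson insertCI subspace_sum)
  then show ?case using insert by fastforce
qed

text \<open>In an orthonormal basis of \<open>E\<close> all coefficients of x are bounded by
  \<open>norm x\<close>, so the triangle inequality for \<nu> suffices.\<close>

lemma norm_on_le_norm:
  fixes E :: "'a::euclidean_space set"
  assumes "subspace E" "norm_on E \<nu>"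
  obtains K where "K > 0" "\<And>x. x \<in> E \<Longrightarrow> \<nu> x \<le> K * norm x"
proof -
  obtain B where B: "B \<subseteq> E" "pairwise orthogonal B" "\<And>x. x \<in> B \<Longrightarrow> norm x = 1"
      "independent B" "span B = E"
    using orthonormal_basis_subspace[OF assms(1)] by metis
  then have fin: "finite B" by (simp add: independent_imp_finite)
  have nn: "\<nu> b \<ge> 0" if "b \<in> E" for b using assms(2) that unfolding norm_on_def by auto
  \<comment> \<open>The summand 1 keeps \<open>K\<close> positive when \<open>E\<close> is trivial
    and the basis empty.\<close>
  define K where "K = (\<Sum>b\<in>B. \<nu> b) + 1"
  have "K > 0" unfolding K_def using B(1) nn by (smt (verit) sum_nonneg subsetD)
  moreover have "\<nu> x \<le> K * norm x" if x: "x \<in> E" for x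
  proof -
    have bx: "b \<bullet> b = 1" if "b \<in> B" for b using B(3)[OF that] by (simp add: dot_square_norm)
    have rep: "x = (\<Sum>b\<in>B. (b \<bullet> x / (b \<bullet> b)) *\<^sub>R b)"
    proof (rule vector_eq_dot_span[of _ B])
      show "x \<in> span B" using x B by simp
      show "(\<Sum>b\<in>B. (b \<bullet> x / (b \<bullet> b)) *\<^sub>R b) \<in> span B"
        by (simp add: span_base span_scale span_sum)
      fix i assume i: "i \<in> B"
      have "i \<bullet> (\<Sum>b\<in>B. (b \<bullet> x / (b \<bullet> b)) *\<^sub>R b) = (\<Sum>b\<in>B. (b \<bullet> x / (b \<bullet> b)) * (i \<bullet> b))"
        by (simp add: inner_sum_right)
      also have "\<dots> = (\<Sum>b\<in>B. if b = i then i \<bullet> x else 0)"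
        using i B(2) bx by (intro sum.cong) (auto simp: pairwise_def orthogonal_def)
      finally show "i \<bullet> x = i \<bullet> (\<Sum>b\<in>B. (b \<bullet> x / (b \<bullet> b)) *\<^sub>R b)" using i fin by simp
    qed
    have "\<nu> x \<le> (\<Sum>b\<in>B. \<nu> ((b \<bullet> x / (b \<bullet> b)) *\<^sub>R b))"
      by (subst rep, rule norm_on_sum_le[OF assms fin])
        (use B(1) assms(1) in \<open>auto simp: subspace_scale\<close>)
    also have "\<dots> = (\<Sum>b\<in>B. \<bar>b \<bullet> x\<bar> * \<nu> b)"
      using assms(2) B(1) bx unfolding norm_on_def by (intro sum.cong) auto
    also have "\<dots> \<le> (\<Sum>b\<in>B. norm x * \<nu> b)"
    proof (intro sum_mono mult_right_mono)
      fix b assume "b \<in> B"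
      then show "\<bar>b \<bullet> x\<bar> \<le> norm x" using Cauchy_Schwarz_ineq2[of b x] B(3) by simp
    qed (use nn B(1) in auto)
    also have "\<dots> \<le> K * norm x" unfolding K_def by (simp add: sum_distrib_left algebra_simps)
    finally show ?thesis .
  qed
  ultimately show thesis using that by blast
qed

text \<open>Nothing is known about \<nu> off \<open>E\<close>, so continuity is relative to
  \<open>E\<close>. The previous bound makes \<nu> Lipschitz there.\<close>

lemma norm_on_continuous:
  fixes E :: "'a::euclidean_space set"
  assumes "subspace E" "norm_on E \<nu>"
  shows "continuous_on E \<nu>"
proof -
  obtain K where K: "K > 0" "\<And>x. x \<in> E \<Longrightarrow> \<nu> x \<le> K * norm x"
    using norm_on_le_norm[OF assms] by blast
  have "K-lipschitz_on E \<nu>"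
  proof (rule lipschitz_onI)
    fix x y assume xy: "x \<in> E" "y \<in> E"
    have "\<nu> x \<le> \<nu> (x - y) + \<nu> y" "\<nu> y \<le> \<nu> (y - x) + \<nu> x"
      using norm_on_triangle[OF assms, of x y 0] norm_on_triangle[OF assms, of y x 0] xy
        subspace_0[OF assms(1)] by auto
    moreover have "\<nu> (x - y) \<le> K * norm (x - y)" using K xy assms(1) by (simp add: subspace_diff)
    ultimately show "dist (\<nu> x) (\<nu> y) \<le> K * dist x y"
      using norm_on_minus_commute[OF assms xy] by (auto simp: dist_norm)
  qed (use K in simp)
  then show ?thesis by (rule lipschitz_on_continuous_on)
qed

text \<open>The constant is the minimum of \<nu> over the compact Euclidean unit sphere of
  \<open>E\<close>, extended by homogeneity. If that sphere is empty, \<open>E\<close> is trivial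
  and any constant works.\<close>

lemma norm_on_ge_norm:
  fixes E :: "'a::euclidean_space set"
  assumes "subspace E" "norm_on E \<nu>"
  obtains c where "c > 0" "\<And>x. x \<in> E \<Longrightarrow> c * norm x \<le> \<nu> x"
proof (cases "E \<inter> sphere 0 1 = {}")
  case True
  have "x = 0" if "x \<in> E" for x
  proof (rule ccontr)
    assume "x \<noteq> 0"
    then have "(1 / norm x) *\<^sub>R x \<in> E \<inter> sphere 0 1" using that assms(1) by (simp add: subspace_scale)
    then show False using True by blast
  qed
  then show thesis using that[of 1] norm_on_zero[OF assms] by (metis mult_1 norm_zero order_refl zero_less_one)
next
  case False
  have "compact (E \<inter> sphere 0 1)"
    using assms(1) by (simp add: closed_Int_compact closed_subspace)
  then obtain u where u: "u \<in> E \<inter> sphere 0 1" "\<And>x. x \<in> E \<inter> sphere 0 1 \<Longrightarrow> \<nu> u \<le> \<nu> x"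
    using continuous_attains_inf[OF _ False] continuous_on_subset[OF norm_on_continuous[OF assms]]
    by (metis inf_le1)
  have "\<nu> u > 0" using u(1) assms(2) unfolding norm_on_def by (force simp: less_le)
  moreover have "\<nu> u * norm x \<le> \<nu> x" if x: "x \<in> E" for x
  proof (cases "x = 0")
    case True
    then show ?thesis using norm_on_zero[OF assms] by simp
  next
    case False
    then have "\<nu> u \<le> \<nu> ((1 / norm x) *\<^sub>R x)" using x assms(1) by (intro u) (simp add: subspace_scale)
    also have "\<dots> = \<bar>1 / norm x\<bar> * \<nu> x" using assms(2) x unfolding norm_on_def by blast
    finally show ?thesis using False by (simp add: field_simps)
  qed
  ultimately show thesis using that by blast
qed

text \<open>A real supremum dominates its members only when they are bounded above. Equivalence with
  the Euclidean norm supplies this bound; scaling x to \<nu>-length 1 then gives the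
  inequality.\<close>

lemma dual_norm_inner_le:
  fixes E :: "'a::euclidean_space set"
  assumes "subspace E" "norm_on E \<nu>" "dual_norm E \<nu> l \<le> M" "x \<in> E"
  shows "\<bar>l \<bullet> x\<bar> \<le> M * \<nu> x"
proof -
  obtain c where c: "c > 0" "\<And>x. x \<in> E \<Longrightarrow> c * norm x \<le> \<nu> x"
    using norm_on_ge_norm[OF assms(1,2)] by blast
  have bdd: "bdd_above ((\<lambda>x. l \<bullet> x) ` {x \<in> E. \<nu> x \<le> 1})"
  proof (rule bdd_aboveI2)
    fix x assume "x \<in> {x \<in> E. \<nu> x \<le> 1}"
    then have "norm x \<le> 1 / c" using c(2)[of x] c(1) by (auto simp: field_simps)
    then have "norm l * norm x \<le> norm l * (1 / c)" by (intro mult_left_mono) auto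
    then show "l \<bullet> x \<le> norm l * (1 / c)" using norm_cauchy_schwarz[of l x] by linarith
  qed
  have le: "l \<bullet> y \<le> M * \<nu> y" if y: "y \<in> E" for y
  proof (cases "y = 0")
    case True
    then show ?thesis using norm_on_zero[OF assms(1,2)] by simp
  next
    case False
    then have pos: "\<nu> y > 0" using assms(2) y unfolding norm_on_def by (force simp: less_le)
    have "\<nu> ((1 / \<nu> y) *\<^sub>R y) = \<bar>1 / \<nu> y\<bar> * \<nu> y" using assms(2) y unfolding norm_on_def by blast
    then have "(1 / \<nu> y) *\<^sub>R y \<in> {x \<in> E. \<nu> x \<le> 1}" using pos y assms(1) by (simp add: subspace_scale)
    then have "l \<bullet> ((1 / \<nu> y) *\<^sub>R y) \<le> dual_norm E \<nu> l"
      unfolding dual_norm_def by (rule cSUP_upper[OF _ bdd])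
    then have "l \<bullet> ((1 / \<nu> y) *\<^sub>R y) \<le> M" using assms(3) by (rule order.trans)
    then show ?thesis using pos by (simp add: field_simps)
  qed
  have "\<nu> (-x) = \<nu> x"
    using norm_on_minus_commute[OF assms(1,2) assms(4) subspace_0[OF assms(1)]] by simp
  then show ?thesis using le[OF assms(4)] le[of "-x"] assms(1,4) by (simp add: subspace_neg)
qed

lemma dual_norm_leI:
  assumes "subspace E" "norm_on E \<nu>" "0 \<le> M" "\<And>x. x \<in> E \<Longrightarrow> l \<bullet> x \<le> M * \<nu> x"
  shows "dual_norm E \<nu> l \<le> M"
  unfolding dual_norm_def
proof (rule cSUP_least)
  show "{x \<in> E. \<nu> x \<le> 1} \<noteq> {}"
    using norm_on_zero[OF assms(1,2)] subspace_0[OF assms(1)] by auto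
  fix x assume x: "x \<in> {x \<in> E. \<nu> x \<le> 1}"
  then have "M * \<nu> x \<le> M * 1" using assms(3) by (intro mult_left_mono) auto
  then show "l \<bullet> x \<le> M" using assms(4)[of x] x by simp
qed

subsection \<open>Packing\<close>

text \<open>Volume comparison in the full space: balls of the coordinate subspace are thickened by a
  fixed box in the complementary coordinates, so that a ball of radius \<open>\<rho>\<close> has volume
  \<open>\<rho> ^ card J\<close> times that of the unit ball.\<close>

lemma packing_coordinate_subspace:
  fixes J :: "'a::euclidean_space set"
  defines "E \<equiv> {x::'a. \<forall>i\<in>Basis. i \<notin> J \<longrightarrow> x \<bullet> i = 0}"
  assumes J: "J \<subseteq> Basis" and \<nu>: "norm_on E \<nu>"
    and S: "finite S" "S \<subseteq> E" and c: "c \<in> E" and r: "0 \<le> r" and s: "0 < s"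
    and ball: "\<And>x. x \<in> S \<Longrightarrow> \<nu> (x - c) \<le> r"
    and sep: "\<And>x y. x \<in> S \<Longrightarrow> y \<in> S \<Longrightarrow> x \<noteq> y \<Longrightarrow> s \<le> \<nu> (x - y)"
  shows "real (card S) \<le> (1 + 2 * r / s) ^ card J"
proof -
  have sub: "subspace E" unfolding E_def by (rule subspace_substandard)
  define \<pi> where "\<pi> x = (\<Sum>j\<in>J. (x \<bullet> j) *\<^sub>R j)" for x :: 'a
  have finJ: "finite J" using J finite_Basis finite_subset by blast
  have \<pi>E: "\<pi> x \<in> E" for x
    unfolding E_def \<pi>_def using J by (auto simp: inner_sum_left inner_Basis intro!: sum.neutral)
  have \<pi>_id: "\<pi> x = x" if "x \<in> E" for x
    unfolding \<pi>_def using that J unfolding E_def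
    by (subst (3) euclidean_representation[symmetric]) (auto intro!: sum.mono_neutral_left)
  have \<pi>_inner: "\<pi> x \<bullet> j = x \<bullet> j" if "j \<in> J" for x j
    unfolding \<pi>_def using that J finJ
    by (auto simp: inner_sum_left inner_Basis subset_iff if_distrib sum.delta cong: if_cong sum.cong)
  have \<pi>_lin: "linear \<pi>"
    unfolding \<pi>_def by (intro linearI) (simp_all add: inner_add_left scaleR_add_left sum.distrib scaleR_sum_right)
  have cont: "continuous_on UNIV \<pi>" using \<pi>_lin linear_continuous_on linear_conv_bounded_linear by blast
  have norm_pos: "\<nu> x \<ge> 0" if "x \<in> E" for x using \<nu> that unfolding norm_on_def by auto
  have hom: "\<nu> (a *\<^sub>R x) = \<bar>a\<bar> * \<nu> x" if "x \<in> E" for a x using \<nu> that unfolding norm_on_def by auto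
  define U where "U c \<rho> = {x. \<nu> (\<pi> x - c) < \<rho> \<and> (\<forall>j\<in>Basis - J. \<bar>x \<bullet> j\<bar> < 1)}" for c :: 'a and \<rho> :: real
  have opU: "open (U c \<rho>)" if "c \<in> E" for c \<rho>
  proof -
    have "continuous_on UNIV (\<nu> \<circ> (\<lambda>x. \<pi> x - c))"
    proof (rule continuous_on_compose)
      show "continuous_on UNIV (\<lambda>x. \<pi> x - c)" using cont by (intro continuous_intros)
      show "continuous_on (range (\<lambda>x. \<pi> x - c)) \<nu>"
        using \<pi>E that sub
        by (intro continuous_on_subset[OF norm_on_continuous[OF sub \<nu>]]) (auto simp: subspace_diff)
    qed
    then have 1: "open {x. \<nu> (\<pi> x - c) < \<rho>}"
      by (intro open_Collect_less) (auto simp: o_def)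
    have "open (\<Inter>j\<in>Basis - J. {x. \<bar>x \<bullet> j\<bar> < 1})"
      by (intro open_INT ballI open_Collect_less continuous_intros) auto
    then have "open {x. \<forall>j\<in>Basis - J. \<bar>x \<bullet> j\<bar> < 1}" by (simp add: INTER_eq)
    then show ?thesis unfolding U_def Collect_conj_eq by (rule open_Int[OF 1])
  qed
  have vol: "emeasure lborel (U c \<rho>) = ennreal (\<rho> ^ card J) * emeasure lborel (U 0 1)"
    if c: "c \<in> E" and \<rho>: "\<rho> > 0" for c \<rho>
  proof -
    \<comment> \<open>The map \<open>T\<close> scales the coordinates in \<open>J\<close> by \<rho>,
      fixes the others and translates by \<open>c\<close>. It carries the unit set onto
      \<open>U c \<rho>\<close>, and its Jacobian is the product of the \<open>k j\<close>, that is
      \<rho> to the power \<open>card J\<close>.\<close>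
    define k where "k j = (if j \<in> J then \<rho> else 1)" for j :: 'a
    define T where "T x = c + (\<Sum>j\<in>Basis. (k j * (x \<bullet> j)) *\<^sub>R j)" for x
    have Tj: "T x \<bullet> j = c \<bullet> j + k j * (x \<bullet> j)" if "j \<in> Basis" for x j
      unfolding T_def using that by (simp add: inner_add_left inner_sum_left inner_Basis if_distrib cong: if_cong)
    have \<pi>T: "\<pi> (T x) - c = \<rho> *\<^sub>R \<pi> x" for x
    proof -
      have "\<pi> (T x) = \<pi> c + \<rho> *\<^sub>R \<pi> x"
        unfolding \<pi>_def using J
        by (auto simp: Tj subset_iff k_def scaleR_add_left sum.distrib scaleR_sum_right)
      then show ?thesis using \<pi>_id[OF c] by simp
    qed
    have pre: "T -` U c \<rho> = U 0 1"
    proof -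
      have "\<nu> (\<pi> (T x) - c) < \<rho> \<longleftrightarrow> \<nu> (\<pi> x - 0) < 1" for x
        using \<rho> hom[OF \<pi>E, of \<rho> x] by (simp add: \<pi>T)
      moreover have "T x \<bullet> j = x \<bullet> j" if "j \<in> Basis - J" for x j
        using that c Tj[of j x] by (simp add: E_def k_def)
      ultimately show ?thesis unfolding U_def by auto
    qed
    have Tm: "T \<in> borel_measurable borel" unfolding T_def by measurable
    have Um: "U c \<rho> \<in> sets borel" using opU[OF c] by simp
    have "lborel = density (distr lborel borel T) (\<lambda>_. (\<Prod>j\<in>Basis. \<bar>k j\<bar>))"
      unfolding T_def using lborel_affine_euclidean[of k c] \<rho> by (auto simp: k_def)
    then have "emeasure lborel (U c \<rho>) =
        emeasure (density (distr lborel borel T) (\<lambda>_. (\<Prod>j\<in>Basis. \<bar>k j\<bar>))) (U c \<rho>)"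
      by simp
    also have "\<dots> = ennreal (\<Prod>j\<in>Basis. \<bar>k j\<bar>) * emeasure lborel (T -` U c \<rho>)"
      using Tm Um by (simp add: emeasure_density nn_integral_cmult_indicator emeasure_distr)
    also have "(\<Prod>j\<in>Basis. \<bar>k j\<bar>) = \<rho> ^ card J"
    proof -
      have "(\<Prod>j\<in>Basis. \<bar>k j\<bar>) = (\<Prod>j\<in>J. \<rho>)"
        using \<rho> J by (intro prod.mono_neutral_cong_right) (auto simp: k_def)
      then show ?thesis by simp
    qed
    finally show ?thesis using pre by simp
  qed
  have 0: "0 \<in> E" by (rule subspace_0[OF sub])
  \<comment> \<open>The unit volume is to be cancelled at the end, so it must be positive (the set
    is open and contains 0) and finite (the set is bounded).\<close>
  have "emeasure lborel (U 0 1) \<noteq> 0"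
  proof -
    have "0 \<in> U 0 1" using norm_on_zero[OF sub \<nu>] \<pi>_id[OF 0] by (simp add: U_def)
    then have "\<not> negligible (U 0 1)" using opU[OF 0] open_not_negligible by blast
    then show ?thesis using opU[OF 0, of 1]
      by (auto simp: negligible_iff_null_sets null_sets_def)
  qed
  moreover have "emeasure lborel (U 0 1) < \<infinity>"
  proof -
    obtain a where a: "a > 0" "\<And>x. x \<in> E \<Longrightarrow> a * norm x \<le> \<nu> x"
      using norm_on_ge_norm[OF sub \<nu>] by blast
    have "\<bar>x \<bullet> j\<bar> \<le> max (1 / a) 1" if x: "x \<in> U 0 1" and j: "j \<in> Basis" for x j
    proof (cases "j \<in> J")
      case True
      have "a * norm (\<pi> x) \<le> 1" using a(2)[OF \<pi>E[of x]] x by (simp add: U_def)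
      then have "norm (\<pi> x) \<le> 1 / a" using a(1) by (simp add: field_simps)
      moreover have "\<bar>\<pi> x \<bullet> j\<bar> \<le> norm (\<pi> x)" using j by (rule Basis_le_norm)
      ultimately show ?thesis using \<pi>_inner[OF True] by simp
    next
      case False
      then show ?thesis using x j by (force simp: U_def)
    qed
    then have "bounded (U 0 1)"
      by (intro bounded_subset[OF bounded_cbox[of "- (\<Sum>j\<in>Basis. max (1 / a) 1 *\<^sub>R j)" "\<Sum>j\<in>Basis. max (1 / a) 1 *\<^sub>R j"]])
        (force simp: mem_box abs_le_iff minus_le_iff)
    then show ?thesis by (rule emeasure_bounded_finite)
  qed
  ultimately obtain V where V: "V > 0" "emeasure lborel (U 0 1) = ennreal V"
    by (cases "emeasure lborel (U 0 1)") (auto simp: less_le)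
  \<comment> \<open>The radius is half the separation: a common point of two such sets would bring
    their centres closer than s, by the triangle inequality for the projected point.\<close>
  have disj: "disjoint_family_on (\<lambda>p. U p (s / 2)) S"
    unfolding disjoint_family_on_def
  proof (intro ballI impI)
    fix p q assume pq: "p \<in> S" "q \<in> S" "p \<noteq> q"
    have "False" if "x \<in> U p (s / 2)" "x \<in> U q (s / 2)" for x
    proof -
      have "\<nu> (p - q) \<le> \<nu> (p - \<pi> x) + \<nu> (\<pi> x - q)"
        using pq S \<pi>E by (intro norm_on_triangle[OF sub \<nu>]) auto
      moreover have "\<nu> (p - \<pi> x) = \<nu> (\<pi> x - p)"
        using pq S \<pi>E by (intro norm_on_minus_commute[OF sub \<nu>]) auto
      ultimately show False using sep[OF pq] that by (simp add: U_def)
    qed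
    then show "U p (s / 2) \<inter> U q (s / 2) = {}" by blast
  qed
  have incl: "(\<Union>p\<in>S. U p (s / 2)) \<subseteq> U c (r + s / 2)"
  proof
    fix x assume "x \<in> (\<Union>p\<in>S. U p (s / 2))"
    then obtain p where p: "p \<in> S" "x \<in> U p (s / 2)" by blast
    have "\<nu> (\<pi> x - c) \<le> \<nu> (\<pi> x - p) + \<nu> (p - c)"
      using p S c \<pi>E by (intro norm_on_triangle[OF sub \<nu>]) auto
    then show "x \<in> U c (r + s / 2)" using ball[OF p(1)] p(2) by (simp add: U_def)
  qed
  have "ennreal (real (card S) * ((s / 2) ^ card J * V)) = (\<Sum>p\<in>S. emeasure lborel (U p (s / 2)))"
    using S s V vol by (simp add: subset_iff ennreal_mult ennreal_of_nat_eq_real_of_nat)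
  also have "\<dots> = emeasure lborel (\<Union>p\<in>S. U p (s / 2))"
    using S opU by (intro sum_emeasure disj) auto
  also have "\<dots> \<le> emeasure lborel (U c (r + s / 2))"
    using opU[OF c] by (intro emeasure_mono incl) auto
  also have "\<dots> = ennreal ((r + s / 2) ^ card J * V)"
    using vol[OF c, of "r + s / 2"] r s V by (simp add: ennreal_mult)
  finally have "real (card S) * ((s / 2) ^ card J * V) \<le> (r + s / 2) ^ card J * V"
    using r s V by (simp add: ennreal_le_iff)
  then have "real (card S) * (s / 2) ^ card J \<le> (r + s / 2) ^ card J" using V by simp
  then have "real (card S) \<le> ((r + s / 2) / (s / 2)) ^ card J"
    unfolding power_divide[of "r + s / 2"] using s by (subst pos_le_divide_eq) auto
  also have "(r + s / 2) / (s / 2) = 1 + 2 * r / s" using s by (simp add: field_simps)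
  finally show ?thesis .
qed

text \<open>A linear bijection onto a coordinate subspace of the same dimension transports points
  and norm alike. Since the norm there may be arbitrary, \<nu> composed with the inverse map is as
  good as \<nu>, and all distances are preserved.\<close>

lemma packing_bound:
  fixes E :: "'a::euclidean_space set"
  assumes sub: "subspace E" and \<nu>: "norm_on E \<nu>"
    and S: "finite S" "S \<subseteq> E" and c: "c \<in> E" and r: "0 \<le> r" and s: "0 < s"
    and ball: "\<And>x. x \<in> S \<Longrightarrow> \<nu> (x - c) \<le> r"
    and sep: "\<And>x y. x \<in> S \<Longrightarrow> y \<in> S \<Longrightarrow> x \<noteq> y \<Longrightarrow> s \<le> \<nu> (x - y)"
  shows "real (card S) \<le> (1 + 2 * r / s) ^ dim E"
proof -
  have "dim E \<le> card (Basis :: 'a set)" using dim_subset_UNIV by auto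
  then obtain J :: "'a set" where J: "J \<subseteq> Basis" "card J = dim E"
    using obtain_subset_with_card_n by metis
  define E' where "E' = {x::'a. \<forall>i\<in>Basis. i \<notin> J \<longrightarrow> x \<bullet> i = 0}"
  have sub': "subspace E'" unfolding E'_def by (rule subspace_substandard)
  have "dim E' = dim E" unfolding E'_def using dim_substandard[OF J(1)] J(2) by simp
  then obtain f g where fg: "linear f" "linear g" "f ` E = E'" "g ` E' = E"
      "\<And>x. x \<in> E \<Longrightarrow> g (f x) = x" "\<And>x. x \<in> E' \<Longrightarrow> f (g x) = x"
    using isometries_subspaces[OF sub sub'] by metis
  have gE: "g x \<in> E" if "x \<in> E'" for x using fg(4) that by blast
  have fE: "f x \<in> E'" if "x \<in> E" for x using fg(3) that by blast
  have g0: "g x = 0 \<longleftrightarrow> x = 0" if "x \<in> E'" for x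
    using fg(6)[OF that] linear_0[OF fg(1)] linear_0[OF fg(2)] by metis
  have \<nu>': "norm_on E' (\<nu> \<circ> g)"
    using \<nu> gE g0 unfolding norm_on_def
    by (simp add: linear_add[OF fg(2)] linear_scale[OF fg(2)])
  have inj: "inj_on f E" by (metis fg(5) inj_onI)
  have g_diff: "g (f x - f y) = x - y" if "x \<in> E" "y \<in> E" for x y
    using that fg(5) by (simp add: linear_diff[OF fg(2)])
  have "real (card (f ` S)) \<le> (1 + 2 * r / s) ^ card J"
  proof (rule packing_coordinate_subspace[OF J(1), folded E'_def, OF \<nu>'])
    show "finite (f ` S)" "f ` S \<subseteq> E'" "f c \<in> E'" using S c fE by auto
    fix x assume "x \<in> f ` S"
    then show "(\<nu> \<circ> g) (x - f c) \<le> r" using g_diff S c ball by (auto simp: subset_iff)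
  next
    fix x y assume "x \<in> f ` S" "y \<in> f ` S" "x \<noteq> y"
    then show "s \<le> (\<nu> \<circ> g) (x - y)" using g_diff S(2) sep by (auto simp: subset_iff) metis
  qed (use r s in auto)
  moreover have "card (f ` S) = card S" using inj S(2) by (meson card_image inj_on_subset)
  ultimately show ?thesis using J(2) by simp
qed

subsection \<open>Conjugates and multipliers\<close>

text \<open>The hypothesis on v says that \<open>G\<close> misses the strict hypograph
  \<open>H\<close> of the concave function v - \<sigma> * \<nu>(xa - z). A hyperplane separating the
  two is not vertical, and its slope is the multiplier. Evaluating at z' = xa gives the duality
  inequality; letting z' recede to infinity in \<open>E\<close> bounds the slope by \<sigma> *
  \<nu>.\<close>

lemma exists_norm_bounded_multiplier:
  fixes E :: "'a::euclidean_space set" and G :: "('a \<times> real) set"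
  assumes sub: "subspace E" and \<nu>: "norm_on E \<nu>" and xa: "xa \<in> E" and \<sigma>: "0 \<le> \<sigma>"
    and G: "convex G" "G \<noteq> {}" "\<And>z t. (z, t) \<in> G \<Longrightarrow> z \<in> E"
    and v: "\<And>z t. (z, t) \<in> G \<Longrightarrow> v \<le> t + \<sigma> * \<nu> (xa - z)"
  obtains l where "l \<in> E" "\<And>x. x \<in> E \<Longrightarrow> l \<bullet> x \<le> \<sigma> * \<nu> x"
    "\<And>z t. (z, t) \<in> G \<Longrightarrow> v \<le> t + l \<bullet> (xa - z)"
proof -
  \<comment> \<open>The hypograph is taken over all of \<open>E\<close>, not just over the first
    components of \<open>G\<close>. This is what rules out a vertical hyperplane and what bounds the
    slope.\<close>
  define H where "H = {(z, s). z \<in> E \<and> s < v - \<sigma> * \<nu> (xa - z)}"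
  have "convex H"
  proof (rule convexI)
    fix p q and u w :: real
    assume "p \<in> H" "q \<in> H" and uw: "0 \<le> u" "0 \<le> w" "u + w = 1"
    then obtain z s z' s' where pq: "p = (z, s)" "q = (z', s')" "z \<in> E" "z' \<in> E"
        "s < v - \<sigma> * \<nu> (xa - z)" "s' < v - \<sigma> * \<nu> (xa - z')"
      unfolding H_def by auto
    have "xa = u *\<^sub>R xa + w *\<^sub>R xa" using uw(3) by (simp flip: scaleR_add_left)
    then have "xa - (u *\<^sub>R z + w *\<^sub>R z') = u *\<^sub>R (xa - z) + w *\<^sub>R (xa - z')"
      by (simp add: algebra_simps)
    then have "\<nu> (xa - (u *\<^sub>R z + w *\<^sub>R z')) \<le> \<nu> (u *\<^sub>R (xa - z)) + \<nu> (w *\<^sub>R (xa - z'))"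
      using \<nu> pq(3,4) xa sub unfolding norm_on_def by (metis subspace_diff subspace_scale)
    also have "\<dots> = u * \<nu> (xa - z) + w * \<nu> (xa - z')"
      using \<nu> pq(3,4) xa sub uw unfolding norm_on_def by (simp add: subspace_diff)
    finally have "\<sigma> * \<nu> (xa - (u *\<^sub>R z + w *\<^sub>R z')) \<le> \<sigma> * (u * \<nu> (xa - z) + w * \<nu> (xa - z'))"
      using \<sigma> by (rule mult_left_mono)
    \<comment> \<open>Strictness survives the convex combination because at least one weight is
      positive; the split decides which one carries it.\<close>
    moreover have "u * s + w * s' < u * (v - \<sigma> * \<nu> (xa - z)) + w * (v - \<sigma> * \<nu> (xa - z'))"
    proof (cases "u = 0")
      case True
      then show ?thesis using pq uw by simp
    next
      case False
      then show ?thesis using pq uw by (intro add_less_le_mono mult_strict_left_mono mult_left_mono) auto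
    qed
    moreover have "u * v + w * v = v" using uw(3) by (metis distrib_right mult_1)
    ultimately have "u * s + w * s' < v - \<sigma> * \<nu> (xa - (u *\<^sub>R z + w *\<^sub>R z'))"
      by (simp add: algebra_simps)
    then show "u *\<^sub>R p + w *\<^sub>R q \<in> H"
      using pq sub unfolding H_def by (simp add: subspace_add subspace_scale)
  qed
  define S where "S = (\<Union>x\<in>G. \<Union>y\<in>H. {x - y})"
  have S: "(z - z', t - s) \<in> S" if "(z, t) \<in> G" "z' \<in> E" "s < v - \<sigma> * \<nu> (xa - z')" for z t z' s
    unfolding S_def H_def using that by force
  have S1: "convex S" unfolding S_def by (rule convex_differences[OF G(1) \<open>convex H\<close>])
  have S2: "0 \<notin> S"
  proof
    assume "0 \<in> S"
    then obtain z t where "(z, t) \<in> G" "t < v - \<sigma> * \<nu> (xa - z)"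
      unfolding S_def H_def by (auto simp: zero_prod_def)
    then show False using v by fastforce
  qed
  obtain z0 t0 where zt0: "(z0, t0) \<in> G" using G(2) by fastforce
  then have S3: "S \<noteq> {}" using S[OF zt0 xa, of "v - \<sigma> * \<nu> (xa - xa) - 1"] by auto
  \<comment> \<open>Taking the normal in the span of the difference set places its first component
    in \<open>E\<close>, as an admissible multiplier requires.\<close>
  obtain a where a: "a \<in> span S" "a \<noteq> 0" "\<And>x. x \<in> S \<Longrightarrow> 0 \<le> a \<bullet> x"
    using separating_hyperplane_set_0_inspan[OF S1 S3 S2] by blast
  obtain \<mu> \<beta> where ab: "a = (\<mu>, \<beta>)" by fastforce
  have "subspace (E \<times> (UNIV :: real set))" using sub subspace_Times subspace_UNIV by blast
  moreover have "S \<subseteq> E \<times> UNIV" unfolding S_def H_def using G(3) sub by (auto simp: subspace_diff)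
  ultimately have "a \<in> E \<times> UNIV" using a(1) span_minimal by blast
  then have \<mu>: "\<mu> \<in> E" using ab by simp
  have sep: "0 \<le> \<mu> \<bullet> (z - z') + \<beta> * (t - s)"
    if "(z, t) \<in> G" "z' \<in> E" "s < v - \<sigma> * \<nu> (xa - z')" for z t z' s
    using a(3)[OF S[OF that]] by (simp add: ab)
  have z0: "z0 \<in> E" using G(3) zt0 by blast
  \<comment> \<open>For negative \<beta> a value s below t0 violates the separation. For \<beta> = 0
    the normal is horizontal, and moving z' by \<mu> makes the inner product negative.\<close>
  have "\<beta> > 0"
  proof (rule ccontr)
    assume "\<not> \<beta> > 0"
    have "\<beta> = 0"
    proof (rule ccontr)
      assume "\<beta> \<noteq> 0"
      define s where "s = min (v - \<sigma> * \<nu> (xa - z0)) t0 - 1"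
      have "0 \<le> \<mu> \<bullet> (z0 - z0) + \<beta> * (t0 - s)"
        by (rule sep[OF zt0 z0]) (simp add: s_def)
      moreover have "\<beta> * (t0 - s) < 0"
        using \<open>\<not> \<beta> > 0\<close> \<open>\<beta> \<noteq> 0\<close> by (intro mult_neg_pos) (auto simp: s_def)
      ultimately show False by simp
    qed
    moreover have "\<mu> \<noteq> 0" using a(2) ab \<open>\<beta> = 0\<close> by (auto simp: zero_prod_def)
    moreover have "z0 + \<mu> \<in> E" using z0 \<mu> sub by (simp add: subspace_add)
    ultimately show False
      using sep[OF zt0, of "z0 + \<mu>" "v - \<sigma> * \<nu> (xa - (z0 + \<mu>)) - 1"]
      by (simp add: inner_gt_zero_iff[symmetric] del: inner_gt_zero_iff)
  qed
  define l where "l = - ((1 / \<beta>) *\<^sub>R \<mu>)"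
  \<comment> \<open>Division by \<beta> and passage to the limit at the open upper end of the
    hypograph.\<close>
  have sep': "0 \<le> t - v + \<sigma> * \<nu> (xa - z') - l \<bullet> (z - z')"
    if "(z, t) \<in> G" "z' \<in> E" for z t z'
  proof (rule field_le_epsilon)
    fix e :: real assume "e > 0"
    then have "0 \<le> (\<mu> \<bullet> (z - z') + \<beta> * (t - (v - \<sigma> * \<nu> (xa - z') - e))) / \<beta>"
      using sep[OF that, of "v - \<sigma> * \<nu> (xa - z') - e"] \<open>\<beta> > 0\<close> by simp
    also have "\<dots> = t - v + \<sigma> * \<nu> (xa - z') - l \<bullet> (z - z') + e"
      using \<open>\<beta> > 0\<close> by (simp add: l_def field_simps)
    finally show "0 \<le> t - v + \<sigma> * \<nu> (xa - z') - l \<bullet> (z - z') + e" .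
  qed
  show thesis
  proof
    show "l \<in> E" unfolding l_def using \<mu> sub by (simp add: subspace_neg subspace_scale)
    fix z t assume "(z, t) \<in> G"
    then show "v \<le> t + l \<bullet> (xa - z)"
      using sep'[OF _ xa] norm_on_zero[OF sub \<nu>] by (fastforce simp: inner_diff_right)
  next
    fix x assume x: "x \<in> E"
    show "l \<bullet> x \<le> \<sigma> * \<nu> x"
    proof (rule ccontr)
      assume "\<not> l \<bullet> x \<le> \<sigma> * \<nu> x"
      define C where "C = t0 - v - l \<bullet> (z0 - xa)"
      \<comment> \<open>A step of this length along x makes the supposed excess of l over \<sigma> *
        \<nu> equal to |C| + 1, which outweighs the constant \<open>C\<close>.\<close>
      define k where "k = (\<bar>C\<bar> + 1) / (l \<bullet> x - \<sigma> * \<nu> x)"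
      have "k \<ge> 0" unfolding k_def using \<open>\<not> l \<bullet> x \<le> \<sigma> * \<nu> x\<close> by simp
      have "xa - k *\<^sub>R x \<in> E" using x xa sub by (simp add: subspace_diff subspace_scale)
      then have "0 \<le> t0 - v + \<sigma> * \<nu> (xa - (xa - k *\<^sub>R x)) - l \<bullet> (z0 - (xa - k *\<^sub>R x))"
        by (rule sep'[OF zt0])
      also have "\<nu> (xa - (xa - k *\<^sub>R x)) = k * \<nu> x"
        using \<nu> x \<open>k \<ge> 0\<close> unfolding norm_on_def by simp
      also have "t0 - v + \<sigma> * (k * \<nu> x) - l \<bullet> (z0 - (xa - k *\<^sub>R x)) = C - k * (l \<bullet> x - \<sigma> * \<nu> x)"
        by (simp add: C_def algebra_simps inner_diff_right inner_add_right)
      also have "k * (l \<bullet> x - \<sigma> * \<nu> x) = \<bar>C\<bar> + 1"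
        unfolding k_def using \<open>\<not> l \<bullet> x \<le> \<sigma> * \<nu> x\<close> by simp
      finally show False by simp
    qed
  qed
qed

text \<open>The Fenchel-Young inequality, with the cases needed for infinite values. Only this upper
  estimate of the convexified approximation is used below.\<close>

lemma biconjugate_on_le:
  assumes "x \<in> E"
  shows "biconjugate_on E g x \<le> g x"
  unfolding biconjugate_on_def conjugate_on_def[of E "conjugate_on E g"]
proof (rule SUP_least)
  fix l assume "l \<in> E"
  have *: "ereal (l \<bullet> x) - g x \<le> conjugate_on E g l"
    unfolding conjugate_on_def using assms by (rule SUP_upper)
  show "ereal (x \<bullet> l) - conjugate_on E g l \<le> g x"
    using * by (cases "g x"; cases "conjugate_on E g l") (auto simp: inner_commute)
qed

subsection \<open>Bounds along a run\<close>

text \<open>As for \<^const>\<open>exp_ctg\<close>, the numeral argument is the number of stages above the leaves.\<close>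

primrec threshold :: "('n, 'a, 'b) problem \<Rightarrow> ('n \<Rightarrow> real) \<Rightarrow> nat \<Rightarrow> 'n \<Rightarrow> real" where
  "threshold P \<delta> 0 n = 0"
| "threshold P \<delta> (Suc k) n = \<delta> n + (\<Sum>m\<in>children P n. cprob P n m * threshold P \<delta> k m)"

locale nested_decomposition =
  fixes P :: "('n, 'a::euclidean_space, 'b::euclidean_space) problem"
    and R :: "('n, 'a, 'b) run" and \<epsilon> :: real and i :: nat
  assumes tree: "scenario_tree P" and data: "regular_data P" and reg: "regularization P"
    and bounds: "multiplier_bounds P" and run: "terminates_at P \<epsilon> R i"
begin

section \<open>The scenario tree and the problem data\<close>

lemma finite_nodes: "finite (nodes P)" and root_node: "root P \<in> nodes P"
  and parent_root: "parent P (root P) \<notin> nodes P"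
  using tree unfolding scenario_tree_def by auto

lemma finite_children: "finite (children P n)"
  using finite_nodes unfolding children_def by simp

lemma finite_nonleaves: "finite (nonleaves P)"
  using finite_nodes unfolding nonleaves_def by simp

lemma nonleaves_nodes: "n \<in> nonleaves P \<Longrightarrow> n \<in> nodes P"
  unfolding nonleaves_def by simp

lemma parent_node: "n \<in> nodes P - {root P} \<Longrightarrow> parent P n \<in> nodes P"
  using tree unfolding scenario_tree_def by blast

lemma child_node:
  assumes "n \<in> nodes P" "m \<in> children P n"
  shows "m \<in> nodes P - {root P}" "parent P m = n" "stage P m = Suc (stage P n)"
proof -
  show "parent P m = n" using assms unfolding children_def by simp
  then show "m \<in> nodes P - {root P}" using assms parent_root unfolding children_def by auto
  then show "stage P m = Suc (stage P n)"
    using tree \<open>parent P m = n\<close> unfolding scenario_tree_def by blast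
qed

lemma nonleaf_iff: "n \<in> nodes P \<Longrightarrow> n \<in> nonleaves P \<longleftrightarrow> stage P n < horizon P"
proof -
  assume n: "n \<in> nodes P"
  have "stage P n \<le> horizon P \<and> (children P n = {} \<longleftrightarrow> stage P n = horizon P)"
    using tree n unfolding scenario_tree_def by blast
  then show ?thesis using n unfolding nonleaves_def by (simp add: order.order_iff_strict) auto
qed

lemma root_nonleaf: "root P \<in> nonleaves P"
proof -
  have "stage P (root P) < horizon P" using tree unfolding scenario_tree_def by linarith
  then show ?thesis using nonleaf_iff[OF root_node] by blast
qed

lemma prob_pos: "n \<in> nodes P \<Longrightarrow> 0 < prob P n" and prob_root: "prob P (root P) = 1"
  using tree unfolding scenario_tree_def by auto

lemma cprob_pos: "n \<in> nodes P \<Longrightarrow> m \<in> children P n \<Longrightarrow> 0 < cprob P n m"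
  using child_node(1)[of n m] prob_pos unfolding cprob_def by simp

lemma xspace_norm:
  assumes "n \<in> nodes P"
  shows "subspace (xspace P n)" "norm_on (xspace P n) (nrm P n)"
    "subspace (xspace P (parent P n))" "norm_on (xspace P (parent P n)) (nrm P (parent P n))"
proof -
  have *: "\<forall>k\<in>insert (parent P (root P)) (nodes P). subspace (xspace P k) \<and> norm_on (xspace P k) (nrm P k)"
    using data unfolding regular_data_def by blast
  show "subspace (xspace P n)" "norm_on (xspace P n) (nrm P n)" using * assms by auto
  have "parent P n \<in> insert (parent P (root P)) (nodes P)"
    using parent_node assms by (cases "n = root P") auto
  then show "subspace (xspace P (parent P n))" "norm_on (xspace P (parent P n)) (nrm P (parent P n))"
    using * by auto
qed

lemma xset_node: "n \<in> nodes P \<Longrightarrow> xset P n = fst ` feas P n"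
  using parent_root unfolding xset_def by auto

lemma xset_xspace: "n \<in> nodes P \<Longrightarrow> x \<in> xset P n \<Longrightarrow> x \<in> xspace P n"
proof -
  assume "n \<in> nodes P" "x \<in> xset P n"
  moreover have "fst ` feas P n \<subseteq> xspace P n"
    using data \<open>n \<in> nodes P\<close> unfolding regular_data_def by blast
  ultimately show ?thesis by (auto simp: xset_node)
qed

lemma xset_parent_xspace:
  assumes "n \<in> nodes P" "x \<in> xset P (parent P n)"
  shows "x \<in> xspace P (parent P n)"
proof (cases "n = root P")
  case True
  then show ?thesis using assms xspace_norm(3)[OF assms(1)] by (auto simp: xset_def subspace_0)
next
  case False
  then show ?thesis using assms xset_xspace parent_node by auto
qed

lemma node_feasD:
  assumes "n \<in> nodes P" "(x, y, z) \<in> node_feas P n"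
  shows "x \<in> xset P n" "z \<in> xset P (parent P n)" "0 \<le> cost P n z y x"
proof -
  have xy: "(x, y) \<in> feas P n" and z: "z \<in> xset P (parent P n)"
    using assms(2) unfolding node_feas_def by simp_all
  show "x \<in> xset P n" unfolding xset_node[OF assms(1)] using xy by force
  show "z \<in> xset P (parent P n)" by (rule z)
  have "\<forall>z\<in>xset P (parent P n). \<forall>(x, y)\<in>feas P n. 0 \<le> cost P n z y x"
    using data assms(1) unfolding regular_data_def by blast
  then show "0 \<le> cost P n z y x" using xy z by fast
qed

lemma pen_nonneg:
  assumes "n \<in> nodes P" "x \<in> xset P (parent P n)" "z \<in> xset P (parent P n)"
  shows "0 \<le> pen P n (x - z)"
proof -
  have "x - z \<in> xspace P (parent P n)"
    using assms xset_parent_xspace xspace_norm(3) by (simp add: subspace_diff)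
  then show ?thesis using reg assms(1) unfolding regularization_def penalty_on_def by (metis (no_types))
qed

text \<open>The penalty vanishes at 0 = x - x, which belongs to the difference set, so the Lipschitz
  condition can be applied against that point.\<close>

lemma pen_le:
  assumes "n \<in> nodes P" "x \<in> xset P (parent P n)" "z \<in> xset P (parent P n)"
  shows "pen P n (x - z) \<le> nrm P (parent P n) (x - z)"
proof -
  have "0 \<in> xspace P (parent P n)" using assms xspace_norm(3) by (simp add: subspace_0)
  then have "pen P n 0 = 0"
    using reg assms(1) unfolding regularization_def penalty_on_def by (metis (no_types))
  moreover have "\<bar>pen P n (x - z) - pen P n (x - x)\<bar> \<le> nrm P (parent P n) ((x - z) - (x - x))"
    using reg assms unfolding regularization_def lipschitz1_on_def Let_def by blast
  ultimately show ?thesis by simp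
qed

lemma sig_pos: "n \<in> nodes P \<Longrightarrow> 0 < sig P n"
  using reg unfolding regularization_def by (auto simp: Let_def)

lemma bounds_nonneg:
  assumes "n \<in> nodes P - {root P}"
  shows "0 \<le> lbnd P n" "0 \<le> rbnd P n" "sig P n \<le> lbnd P n + rbnd P n"
proof -
  have *: "0 \<le> lbnd P n \<and> 0 \<le> rbnd P n \<and>
      (if convex_norm_problem P then sig P n \<le> lbnd P n \<and> rbnd P n = 0 else sig P n \<le> rbnd P n)"
    using bounds assms unfolding multiplier_bounds_def by blast
  then show "0 \<le> lbnd P n" "0 \<le> rbnd P n" by blast+
  show "sig P n \<le> lbnd P n + rbnd P n" using * by (auto split: if_splits)
qed

lemma reg_cost_nonneg:
  assumes "n \<in> nodes P" "(x, y, z) \<in> node_feas P n" "xa \<in> xset P (parent P n)"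
  shows "0 \<le> reg_cost P n xa z y x"
  using node_feasD[OF assms(1,2)] pen_nonneg[OF assms(1,3)] sig_pos[OF assms(1)]
  unfolding reg_cost_def by simp

text \<open>A sum of finite total leaves every cost finite because all probabilities are positive.
  The resulting point, with z copied from the parent, is the competitor that makes every minimum
  below finite.\<close>

lemma feasible_point:
  obtains x y where "\<forall>n\<in>nodes P. (x n, y n, x (parent P n)) \<in> node_feas P n"
    "\<forall>n\<in>nodes P. cost P n (x (parent P n)) (y n) (x n) < \<infinity>"
proof -
  obtain x y where xy: "x (parent P (root P)) = 0" "\<forall>n\<in>nodes P. (x n, y n) \<in> feas P n"
      "(\<Sum>n\<in>nodes P. ereal (prob P n) * cost P n (x (parent P n)) (y n) (x n)) < \<infinity>"
    using data unfolding regular_data_def by blast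
  have nf: "(x n, y n, x (parent P n)) \<in> node_feas P n" if n: "n \<in> nodes P" for n
  proof (cases "n = root P")
    case True
    then show ?thesis using xy n by (simp add: node_feas_def xset_def)
  next
    case False
    then have "parent P n \<in> nodes P" using n parent_node by simp
    then show ?thesis using xy n by (force simp: node_feas_def xset_node)
  qed
  moreover have "cost P n (x (parent P n)) (y n) (x n) < \<infinity>" if n: "n \<in> nodes P" for n
  proof -
    have "ereal (prob P n) * cost P n (x (parent P n)) (y n) (x n) \<noteq> \<infinity>"
      using xy(3) n finite_nodes by (auto simp: less_top[symmetric] sum_Pinfty)
    then show ?thesis using prob_pos[OF n] by auto
  qed
  ultimately show thesis using that by blast
qed

section \<open>Iterates of a run\<close>

lemma init: "initialization P R"
  using run unfolding terminates_at_def by blast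

lemma steps:
  assumes "j \<in> {1..i}"
  shows "forward_step P R j" "update_step P R j" "backward_step P R j" "root_step P R j"
    "ereal \<epsilon> < UB R (j - 1) - LB R (j - 1)"
  using run assms unfolding terminates_at_def by blast+

text \<open>The j-th root iterate is computed at the end of iteration j - 1, for j = 1 in the
  initialization. Stated with the index j - 1, it relates to the approximations just as the forward
  iterates of the other nodes do, and both origins are treated alike from here on.\<close>

lemma root_iterate:
  assumes "j \<in> {1..i}"
  shows "is_arg_min (root_value P (lowQ R (j - 1) (root P))) (\<lambda>xy. xy \<in> feas P (root P))
      (xit R j (root P), yit R j (root P))" (is ?argmin)
    and "LB R (j - 1) = root_value P (lowQ R (j - 1) (root P)) (xit R j (root P), yit R j (root P))"
      (is ?LB)
    and "UB R (j - 1) \<le> root_value P (upQ R (j - 1) (root P)) (xit R j (root P), yit R j (root P))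
      \<or> UB R (j - 1) = \<infinity> \<and> upQ R (j - 1) (root P) (xit R j (root P)) = \<infinity>" (is ?UB)
proof -
  have *: "?argmin \<and> ?LB \<and> ?UB"
  proof (cases "j = 1")
    case True
    have ini: "\<forall>n\<in>nodes P. \<forall>x\<in>xspace P n. lowQ R 0 n x = 0"
        "\<forall>n\<in>nonleaves P. \<forall>x\<in>xspace P n. upQ R 0 n x = \<infinity>"
        "is_arg_min (root_value P (\<lambda>x. 0)) (\<lambda>xy. xy \<in> feas P (root P))
          (xit R 1 (root P), yit R 1 (root P))"
        "LB R 0 = root_value P (\<lambda>x. 0) (xit R 1 (root P), yit R 1 (root P))" "UB R 0 = \<infinity>"
      using init unfolding initialization_def by auto
    have feas_xspace: "fst w \<in> xspace P (root P)" if "w \<in> feas P (root P)" for w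
      using xset_xspace[OF root_node] that unfolding xset_node[OF root_node] by blast
    have root_eq: "root_value P (lowQ R 0 (root P)) w = root_value P (\<lambda>x. 0) w"
      if "w \<in> feas P (root P)" for w
      using feas_xspace[OF that] ini(1) root_node unfolding root_value_def case_prod_beta by simp
    have f: "(xit R 1 (root P), yit R 1 (root P)) \<in> feas P (root P)"
      using ini(3) unfolding is_arg_min_def by (rule conjunct1)
    have "upQ R 0 (root P) (xit R 1 (root P)) = \<infinity>"
      using ini(2) root_nonleaf feas_xspace[OF f] by simp
    moreover have "is_arg_min (root_value P (lowQ R 0 (root P))) (\<lambda>xy. xy \<in> feas P (root P))
        (xit R 1 (root P), yit R 1 (root P))"
      unfolding is_arg_min_def using ini(3)[unfolded is_arg_min_def] root_eq f by metis
    moreover have "LB R 0 = root_value P (lowQ R 0 (root P)) (xit R 1 (root P), yit R 1 (root P))"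
      using ini(4) root_eq[OF f] by (rule trans[OF _ sym])
    ultimately show ?thesis using ini(5) unfolding True diff_self_eq_0 by (intro conjI disjI2)
  next
    case False
    \<comment> \<open>The root step of iteration j - 1 stores its new point under the index
      \<open>Suc (j - 1)\<close>.\<close>
    then have j: "j - 1 \<in> {1..i}" "Suc (j - 1) = j" using assms by auto
    note step = steps(4)[OF j(1), unfolded root_step_def Let_def j(2)]
    have "UB R (j - 1) = (if root_value P (upQ R (j - 1) (root P)) (xit R j (root P), yit R j (root P))
          < UB R (j - 1 - 1)
        then root_value P (upQ R (j - 1) (root P)) (xit R j (root P), yit R j (root P))
        else UB R (j - 1 - 1))"
      by (rule step[THEN conjunct2, THEN conjunct2, THEN conjunct1])
    then have "UB R (j - 1) \<le> root_value P (upQ R (j - 1) (root P)) (xit R j (root P), yit R j (root P))"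
      by (metis not_less order_refl)
    then show ?thesis
      using step[THEN conjunct1] step[THEN conjunct2, THEN conjunct1]
      by (intro conjI disjI1)
  qed
  show ?argmin by (rule *[THEN conjunct1])
  show ?LB by (rule *[THEN conjunct2, THEN conjunct1])
  show ?UB by (rule *[THEN conjunct2, THEN conjunct2])
qed

lemma iterate_feas:
  assumes "j \<in> {1..i}" "n \<in> nodes P - {root P}"
  shows "(xit R j n, yit R j n, zit R j n) \<in> node_feas P n"
  using steps(1)[OF assms(1)] assms(2) unfolding forward_step_def is_arg_min_def by blast

lemma iterate_xset:
  assumes "j \<in> {1..i}" "n \<in> nodes P"
  shows "xit R j n \<in> xset P n"
proof (cases "n = root P")
  case True
  have "(xit R j (root P), yit R j (root P)) \<in> feas P (root P)"
    using root_iterate(1)[OF assms(1)] unfolding is_arg_min_def by blast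
  then show ?thesis using True by (force simp: xset_node[OF root_node])
next
  case False
  then show ?thesis using iterate_feas[OF assms(1)] node_feasD(1) assms(2) by blast
qed

lemma leaf_zero:
  assumes "n \<in> nodes P" "n \<notin> nonleaves P" "x \<in> xset P n"
  shows "lowQ R j n x = 0" "upQ R j n x = 0"
  using init assms xset_xspace unfolding initialization_def by auto

section \<open>Monotonicity of the approximations\<close>

lemma lowQ_Suc_ge:
  assumes "Suc j \<in> {1..i}" "n \<in> nodes P" "x \<in> xset P n"
  shows "lowQ R j n x \<le> lowQ R (Suc j) n x"
proof (cases "n \<in> nonleaves P")
  case True
  then show ?thesis
    using steps(2)[OF assms(1)] xset_xspace[OF assms(2,3)] unfolding update_step_def by simp
next
  case False
  then show ?thesis using leaf_zero[OF assms(2) False assms(3)] by simp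
qed

text \<open>Convexification can only lower the minimum, so the convex and the nonconvex update obey
  the same upper bound.\<close>

lemma upQ_Suc_le_min:
  assumes "Suc j \<in> {1..i}" "n \<in> nonleaves P" "x \<in> xset P n"
  shows "upQ R (Suc j) n x \<le> min (upQ R j n x) (up_cone P R (Suc j) n x)"
proof -
  have x: "x \<in> xspace P n" using xset_xspace assms nonleaves_nodes by blast
  have "upQ R (Suc j) n x =
          (if convex_problem P
           then biconjugate_on (xspace P n) (\<lambda>u. min (upQ R j n u) (up_cone P R (Suc j) n u)) x
           else min (upQ R j n x) (up_cone P R (Suc j) n x))"
    using steps(2)[OF assms(1)] assms(2) x unfolding update_step_def by simp
  then show ?thesis
    using biconjugate_on_le[OF x, of "\<lambda>u. min (upQ R j n u) (up_cone P R (Suc j) n u)"]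
    by (cases "convex_problem P") auto
qed

lemma upQ_Suc_le:
  assumes "Suc j \<in> {1..i}" "n \<in> nodes P" "x \<in> xset P n"
  shows "upQ R (Suc j) n x \<le> upQ R j n x"
proof (cases "n \<in> nonleaves P")
  case True
  then show ?thesis using upQ_Suc_le_min[OF assms(1) True assms(3)] by simp
next
  case False
  then show ?thesis using leaf_zero[OF assms(2) False assms(3)] by simp
qed

lemma lowQ_mono:
  assumes "j \<le> k" "k \<le> i" "n \<in> nodes P" "x \<in> xset P n"
  shows "lowQ R j n x \<le> lowQ R k n x"
  using assms(1,2)
proof (induction k rule: dec_induct)
  case (step k)
  then show ?case using lowQ_Suc_ge[OF _ assms(3,4), of k] by fastforce
qed simp

lemma upQ_antimono:
  assumes "j \<le> k" "k \<le> i" "n \<in> nodes P" "x \<in> xset P n"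
  shows "upQ R k n x \<le> upQ R j n x"
  using assms(1,2)
proof (induction k rule: dec_induct)
  case (step k)
  then show ?case using upQ_Suc_le[OF _ assms(3,4), of k] by fastforce
qed simp

text \<open>Convexity of the lower approximations is needed only when the multipliers have \<open>\<rho> = 0\<close>, where
  strong duality has to come from convexity; all cuts are affine then.\<close>

definition tame :: "nat \<Rightarrow> 'n \<Rightarrow> bool" where
  "tame j n \<longleftrightarrow> (\<exists>g. (\<forall>x\<in>xset P n. lowQ R j n x = ereal (g x) \<and> 0 \<le> g x) \<and>
     (convex_norm_problem P \<longrightarrow> convex_on (xset P n) g))"

section \<open>Cut values and strong duality for the node problems\<close>

lemma multiplier_iterate:
  assumes "j \<in> {1..i}" "n \<in> nodes P - {root P}"
  shows "(lamit R j n, rhoit R j n) \<in> multipliers P n"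
    and "lowv R j n = dual_fun P n (xit R j (parent P n)) (lowQ R j n) (lamit R j n, rhoit R j n)"
    and "u \<in> multipliers P n \<Longrightarrow>
      dual_fun P n (xit R j (parent P n)) (lowQ R j n) u \<le> lowv R j n"
proof -
  let ?D = "dual_fun P n (xit R j (parent P n)) (lowQ R j n)"
  have b: "lowv R j n = (SUP u\<in>multipliers P n. ?D u)"
      "is_arg_max ?D (\<lambda>u. u \<in> multipliers P n) (lamit R j n, rhoit R j n)"
    using steps(3)[OF assms(1)] assms(2) unfolding backward_step_def Let_def by blast+
  then show in_mult: "(lamit R j n, rhoit R j n) \<in> multipliers P n"
    unfolding is_arg_max_def by blast
  show le: "?D u \<le> lowv R j n" if "u \<in> multipliers P n" for u
    unfolding b(1) using that by (rule SUP_upper)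
  have "lowv R j n \<le> ?D (lamit R j n, rhoit R j n)"
    unfolding b(1) using b(2) unfolding is_arg_max_def by (intro SUP_least) force
  then show "lowv R j n = ?D (lamit R j n, rhoit R j n)" using le[OF in_mult] by (rule antisym)
qed

text \<open>Whatever the multiplier, the finite-cost feasible point competes in the inner minimum,
  and the multiplier terms are real.\<close>

lemma lowv_finite:
  assumes "j \<in> {1..i}" "n \<in> nodes P - {root P}" "tame j n"
  shows "lowv R j n < \<infinity>"
proof -
  obtain x y where "\<forall>n\<in>nodes P. (x n, y n, x (parent P n)) \<in> node_feas P n"
      "\<forall>n\<in>nodes P. cost P n (x (parent P n)) (y n) (x n) < \<infinity>"
    by (rule feasible_point)
  with assms(2) have xy: "(x n, y n, x (parent P n)) \<in> node_feas P n"
      "cost P n (x (parent P n)) (y n) (x n) < \<infinity>"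
    by blast+
  obtain g where g: "\<forall>x\<in>xset P n. lowQ R j n x = ereal (g x)" using assms(3) unfolding tame_def by blast
  let ?e = "ereal (lamit R j n \<bullet> (xit R j (parent P n) - x (parent P n)) +
      rhoit R j n * pen P n (xit R j (parent P n) - x (parent P n)))"
  have "lowv R j n \<le> (case (x n, y n, x (parent P n)) of (x, y, z) \<Rightarrow>
      cost P n z y x + ereal (lamit R j n \<bullet> (xit R j (parent P n) - z) +
      rhoit R j n * pen P n (xit R j (parent P n) - z)) + lowQ R j n x)"
    unfolding multiplier_iterate(2)[OF assms(1,2)] dual_fun_def prod.case
    by (rule INF_lower2[OF xy(1)]) simp
  also have "\<dots> = cost P n (x (parent P n)) (y n) (x n) + ?e + ereal (g (x n))"
    using g node_feasD(1)[OF _ xy(1)] assms(2) by simp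
  also have "\<dots> < \<infinity>" using xy(2) by simp
  finally show ?thesis .
qed

text \<open>Strong duality for the node problem: the multiplier \<open>(0, \<sigma>\<^sub>n)\<close> suffices if it is admissible;
  in the convex norm case a separating hyperplane yields a multiplier \<open>(\<lambda>, 0)\<close>.\<close>

lemma lowv_ge:
  assumes j: "j \<in> {1..i}" and n: "n \<in> nodes P - {root P}" and tame: "tame j n"
    and v: "\<And>x y z. (x, y, z) \<in> node_feas P n \<Longrightarrow>
      ereal v \<le> reg_cost P n (xit R j (parent P n)) z y x + lowQ R j n x"
  shows "ereal v \<le> lowv R j n"
proof -
  let ?a = "parent P n" and ?xa = "xit R j (parent P n)"
  have nn: "n \<in> nodes P" using n by simp
  note sub = xspace_norm(3)[OF nn] and \<nu> = xspace_norm(4)[OF nn]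
  have xa: "?xa \<in> xset P ?a" using iterate_xset[OF j] parent_node[OF n] by blast
  then have xaE: "?xa \<in> xspace P ?a" using xset_parent_xspace[OF nn] by blast
  show ?thesis
  proof (cases "convex_norm_problem P")
    case False
    have "dual_norm (xspace P ?a) (nrm P ?a) 0 \<le> 0"
      by (rule dual_norm_leI[OF sub \<nu>]) auto
    then have "(0, sig P n) \<in> multipliers P n"
      using bounds n False sig_pos[OF nn] subspace_0[OF sub]
      unfolding multipliers_def multiplier_bounds_def by force
    then have "dual_fun P n ?xa (lowQ R j n) (0, sig P n) \<le> lowv R j n"
      by (rule multiplier_iterate(3)[OF j n])
    moreover have "ereal v \<le> dual_fun P n ?xa (lowQ R j n) (0, sig P n)"
      unfolding dual_fun_def using v by (auto intro!: INF_greatest simp: reg_cost_def)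
    ultimately show ?thesis by (rule order.trans[rotated])
  next
    case True
    obtain g where g: "\<And>x. x \<in> xset P n \<Longrightarrow> lowQ R j n x = ereal (g x)"
        "\<And>x. x \<in> xset P n \<Longrightarrow> 0 \<le> g x" "convex_on (xset P n) g"
      using tame True unfolding tame_def by blast
    have bnd: "sig P n \<le> lbnd P n" "rbnd P n = 0"
      using bounds n True unfolding multiplier_bounds_def by auto
    have pen: "pen P n (?xa - z) = nrm P ?a (?xa - z)" if "z \<in> xset P ?a" for z
      using True n xset_parent_xspace[OF nn that] xaE sub
      unfolding convex_norm_problem_def by (simp add: subspace_diff)
    have cvx: "econvex_on (xset P ?a \<times> feas P n) (\<lambda>(z, x, y). cost P n z y x)"
      using True nn unfolding convex_norm_problem_def convex_problem_def by blast
    \<comment> \<open>This is the epigraph of the node problem as a function of z alone, with x and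
      y projected out. Joint convexity of the cost makes it convex, and triples of infinite cost
      drop out of it.\<close>
    define G where "G = {(z, t). \<exists>x y. (x, y, z) \<in> node_feas P n \<and> cost P n z y x + lowQ R j n x \<le> ereal t}"
    have GE: "z \<in> xset P ?a" if "(z, t) \<in> G" for z t
      using that node_feasD[OF nn] unfolding G_def by blast
    have Gcost: "\<exists>k. cost P n z y x = ereal k \<and> k + g x \<le> t"
      if "(x, y, z) \<in> node_feas P n" "cost P n z y x + lowQ R j n x \<le> ereal t" for x y z t
      using that node_feasD[OF nn that(1)] g(1)[of x] by (cases "cost P n z y x") auto
    have "convex G"
      unfolding convex_alt
    proof (intro ballI allI impI)
      fix p q and c :: real
      assume "p \<in> G" "q \<in> G" and c: "0 \<le> c \<and> c \<le> 1"
      then obtain z t x y z' t' x' y' where pq: "p = (z, t)" "q = (z', t')"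
          "(x, y, z) \<in> node_feas P n" "cost P n z y x + lowQ R j n x \<le> ereal t"
          "(x', y', z') \<in> node_feas P n" "cost P n z' y' x' + lowQ R j n x' \<le> ereal t'"
        unfolding G_def by blast
      obtain k k' where k: "cost P n z y x = ereal k" "k + g x \<le> t"
          "cost P n z' y' x' = ereal k'" "k' + g x' \<le> t'"
        using Gcost pq by metis
      let ?z = "(1 - c) *\<^sub>R z + c *\<^sub>R z'" and ?x = "(1 - c) *\<^sub>R x + c *\<^sub>R x'"
        and ?y = "(1 - c) *\<^sub>R y + c *\<^sub>R y'"
      have mem: "(z, x, y) \<in> xset P ?a \<times> feas P n" "(z', x', y') \<in> xset P ?a \<times> feas P n"
        using pq unfolding node_feas_def by auto
      have "convex (xset P ?a \<times> feas P n)" using cvx unfolding econvex_on_def by blast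
      then have "(1 - c) *\<^sub>R (z, x, y) + c *\<^sub>R (z', x', y') \<in> xset P ?a \<times> feas P n"
        using mem c unfolding convex_alt by blast
      then have nf: "(?x, ?y, ?z) \<in> node_feas P n" unfolding node_feas_def by simp
      have "(case (1 - c) *\<^sub>R (z, x, y) + c *\<^sub>R (z', x', y') of (z, x, y) \<Rightarrow> cost P n z y x)
          \<le> ereal (1 - c) * cost P n z y x + ereal c * cost P n z' y' x'"
        using cvx mem c unfolding econvex_on_def by fastforce
      then have "cost P n ?z ?y ?x \<le> ereal ((1 - c) * k + c * k')" by (simp add: k)
      moreover have "lowQ R j n ?x \<le> ereal ((1 - c) * g x + c * g x')"
        using g(1)[OF node_feasD(1)[OF nn nf]] convex_onD[OF g(3), of c x x'] c
          node_feasD(1)[OF nn pq(3)] node_feasD(1)[OF nn pq(5)] by simp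
      ultimately have "cost P n ?z ?y ?x + lowQ R j n ?x
          \<le> ereal ((1 - c) * k + c * k') + ereal ((1 - c) * g x + c * g x')"
        by (rule add_mono)
      also have "\<dots> = ereal ((1 - c) * (k + g x) + c * (k' + g x'))" by (simp add: algebra_simps)
      also have "\<dots> \<le> ereal ((1 - c) * t + c * t')"
        using k c by (auto intro!: add_mono mult_left_mono)
      finally show "(1 - c) *\<^sub>R p + c *\<^sub>R q \<in> G"
        using nf unfolding G_def pq(1,2) by auto
    qed
    moreover have "G \<noteq> {}"
    proof -
      obtain x y where "\<forall>n\<in>nodes P. (x n, y n, x (parent P n)) \<in> node_feas P n"
          "\<forall>n\<in>nodes P. cost P n (x (parent P n)) (y n) (x n) < \<infinity>"
        by (rule feasible_point)
      with nn have xy: "(x n, y n, x ?a) \<in> node_feas P n" "cost P n (x ?a) (y n) (x n) < \<infinity>"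
        by blast+
      obtain k where "cost P n (x ?a) (y n) (x n) = ereal k"
        using xy(2) node_feasD(3)[OF nn xy(1)] by (cases "cost P n (x ?a) (y n) (x n)") auto
      then have "cost P n (x ?a) (y n) (x n) + lowQ R j n (x n) \<le> ereal (k + g (x n))"
        using g(1)[OF node_feasD(1)[OF nn xy(1)]] by simp
      then have "(x ?a, k + g (x n)) \<in> G" using xy(1) unfolding G_def by blast
      then show ?thesis by blast
    qed
    moreover have "v \<le> t + sig P n * nrm P ?a (?xa - z)" if zt: "(z, t) \<in> G" for z t
    proof -
      obtain x y where xy: "(x, y, z) \<in> node_feas P n" "cost P n z y x + lowQ R j n x \<le> ereal t"
        using zt unfolding G_def by blast
      obtain k where k: "cost P n z y x = ereal k" "k + g x \<le> t" using Gcost xy by metis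
      then show ?thesis
        using v[OF xy(1)] pen[OF GE[OF zt]] g(1)[OF node_feasD(1)[OF nn xy(1)]]
        by (simp add: reg_cost_def)
    qed
    ultimately obtain l where l: "l \<in> xspace P ?a"
        "\<And>x. x \<in> xspace P ?a \<Longrightarrow> l \<bullet> x \<le> sig P n * nrm P ?a x"
        "\<And>z t. (z, t) \<in> G \<Longrightarrow> v \<le> t + l \<bullet> (?xa - z)"
      using exists_norm_bounded_multiplier[OF sub \<nu> xaE, of "sig P n" G v] sig_pos[OF nn] GE
        xset_parent_xspace[OF nn] by (metis less_imp_le)
    have "dual_norm (xspace P ?a) (nrm P ?a) l \<le> sig P n"
      using l(2) sig_pos[OF nn] by (intro dual_norm_leI[OF sub \<nu>]) auto
    then have "(l, 0) \<in> multipliers P n" using l(1) bnd unfolding multipliers_def by simp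
    then have "dual_fun P n ?xa (lowQ R j n) (l, 0) \<le> lowv R j n"
      by (rule multiplier_iterate(3)[OF j n])
    moreover have "ereal v \<le> cost P n z y x + ereal (l \<bullet> (?xa - z)) + lowQ R j n x"
      if w: "(x, y, z) \<in> node_feas P n" for x y z
    proof (cases "cost P n z y x")
      case (real k)
      have "(z, k + g x) \<in> G"
        unfolding G_def using w real g(1)[OF node_feasD(1)[OF nn w]]
        by (auto intro!: exI[of _ x] exI[of _ y])
      then show ?thesis using l(3) real g(1)[OF node_feasD(1)[OF nn w]] by force
    qed (use node_feasD(3)[OF nn w] g(1)[OF node_feasD(1)[OF nn w]] in auto)
    then have "ereal v \<le> dual_fun P n ?xa (lowQ R j n) (l, 0)"
      unfolding dual_fun_def by (auto intro!: INF_greatest)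
    ultimately show ?thesis by (rule order.trans[rotated])
  qed
qed

text \<open>The value minus infinity is excluded by strong duality itself: cost, penalty and lower
  approximation are nonnegative, so v = 0 is an admissible bound.\<close>

lemma lowv_real:
  assumes "j \<in> {1..i}" "n \<in> nodes P - {root P}" "tame j n"
  obtains v where "lowv R j n = ereal v"
proof -
  have "ereal 0 \<le> lowv R j n"
  proof (rule lowv_ge[OF assms])
    fix x y z assume w: "(x, y, z) \<in> node_feas P n"
    have "0 \<le> reg_cost P n (xit R j (parent P n)) z y x"
      using w assms iterate_xset parent_node by (intro reg_cost_nonneg) auto
    moreover have "0 \<le> lowQ R j n x"
      using assms(2,3) w node_feasD(1) unfolding tame_def by fastforce
    ultimately show "ereal 0 \<le> reg_cost P n (xit R j (parent P n)) z y x + lowQ R j n x"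
      by (simp add: zero_ereal_def[symmetric])
  qed
  then show thesis using lowv_finite[OF assms] that by (cases "lowv R j n") auto
qed

section \<open>Finiteness and convexity of the lower approximations\<close>

lemma cut_real:
  assumes "lowv R j n = ereal v"
  shows "cut P R j n x = ereal (- (lamit R j n \<bullet> (xit R j (parent P n) - x))
     - rhoit R j n * pen P n (xit R j (parent P n) - x) + v)"
  using assms unfolding cut_def by (simp add: Let_def)

lemma convex_xset:
  assumes "convex_norm_problem P" "n \<in> nodes P"
  shows "convex (xset P n)"
proof -
  have "convex (feas P n)"
    using assms unfolding convex_norm_problem_def convex_problem_def by blast
  then show ?thesis unfolding xset_node[OF assms(2)] by (rule convex_linear_image[OF linear_fst])
qed

lemma tame_zero:
  assumes "n \<in> nodes P" "\<forall>x\<in>xset P n. lowQ R j n x = 0"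
  shows "tame j n"
  using assms convex_xset[OF _ assms(1)] unfolding tame_def
  by (intro exI[of _ "\<lambda>_. 0"]) (auto simp: zero_ereal_def convex_on_const)

text \<open>In the convex norm case all \<rho> vanish, hence the averaged cut is affine and the
  update is a maximum of two convex functions. Real values come from the finite cut values of the
  children, the sign from the old approximation.\<close>

lemma tame_step:
  assumes j: "Suc j \<in> {1..i}" and n: "n \<in> nonleaves P" and tame_old: "tame j n"
    and tame_child: "\<And>m. m \<in> children P n \<Longrightarrow> tame (Suc j) m"
  shows "tame (Suc j) n"
proof -
  have nn: "n \<in> nodes P" using nonleaves_nodes[OF n] .
  note ch = child_node[OF nn]
  obtain g where g: "\<And>x. x \<in> xset P n \<Longrightarrow> lowQ R j n x = ereal (g x)"
      "\<And>x. x \<in> xset P n \<Longrightarrow> 0 \<le> g x" "convex_norm_problem P \<Longrightarrow> convex_on (xset P n) g"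
    using tame_old unfolding tame_def by blast
  define v where "v m = real_of_ereal (lowv R (Suc j) m)" for m
  have v: "lowv R (Suc j) m = ereal (v m)" if "m \<in> children P n" for m
    using lowv_real[OF j ch(1)[OF that] tame_child[OF that]] unfolding v_def
    by (metis real_of_ereal.simps(1))
  define c where "c m x = - (lamit R (Suc j) m \<bullet> (xit R (Suc j) n - x))
     - rhoit R (Suc j) m * pen P m (xit R (Suc j) n - x) + v m" for m x
  define h where "h x = (\<Sum>m\<in>children P n. cprob P n m * c m x)" for x
  have c: "cut P R (Suc j) m x = ereal (c m x)" if "m \<in> children P n" for m x
    unfolding c_def using cut_real[OF v[OF that]] ch(2)[OF that] by simp
  have low: "lowQ R (Suc j) n x = ereal (max (g x) (h x))" if x: "x \<in> xset P n" for x
  proof -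
    have "lowQ R (Suc j) n x =
        max (lowQ R j n x) (\<Sum>m\<in>children P n. ereal (cprob P n m) * cut P R (Suc j) m x)"
      using steps(2)[OF j] n xset_xspace[OF nn x] unfolding update_step_def by simp
    then show ?thesis using g(1)[OF x] by (simp add: c h_def ereal_max)
  qed
  moreover have "convex_on (xset P n) (\<lambda>x. max (g x) (h x))" if cn: "convex_norm_problem P"
  proof -
    have \<rho>: "rhoit R (Suc j) m = 0" if m: "m \<in> children P n" for m
      using multiplier_iterate(1)[OF j ch(1)[OF m]] bounds ch(1)[OF m] cn
      unfolding multipliers_def multiplier_bounds_def by auto
    \<comment> \<open>Slope and intercept of the averaged cut.\<close>
    define a b where "a = (\<Sum>m\<in>children P n. cprob P n m *\<^sub>R lamit R (Suc j) m)"
      and "b = (\<Sum>m\<in>children P n. cprob P n m * (v m - lamit R (Suc j) m \<bullet> xit R (Suc j) n))"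
    have h: "h x = a \<bullet> x + b" for x
      unfolding h_def a_def b_def inner_sum_left sum.distrib[symmetric]
      by (intro sum.cong) (auto simp: c_def \<rho> inner_diff_right algebra_simps)
    have cg: "convex_on (xset P n) g" using g(3) cn by blast
    show ?thesis
    proof (rule convex_onI)
      fix t :: real and x y assume t: "0 < t" "t < 1" and xy: "x \<in> xset P n" "y \<in> xset P n"
      have "g ((1 - t) *\<^sub>R x + t *\<^sub>R y) \<le> (1 - t) * g x + t * g y"
        using convex_onD[OF cg] t xy by simp
      moreover have "h ((1 - t) *\<^sub>R x + t *\<^sub>R y) = (1 - t) * h x + t * h y"
        unfolding h by (simp add: inner_add_right algebra_simps)
      moreover have "(1 - t) * g x \<le> (1 - t) * max (g x) (h x)" "t * g y \<le> t * max (g y) (h y)"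
          "(1 - t) * h x \<le> (1 - t) * max (g x) (h x)" "t * h y \<le> t * max (g y) (h y)"
        using t by (auto intro!: mult_left_mono)
      ultimately show "max (g ((1 - t) *\<^sub>R x + t *\<^sub>R y)) (h ((1 - t) *\<^sub>R x + t *\<^sub>R y))
          \<le> (1 - t) * max (g x) (h x) + t * max (g y) (h y)"
        by linarith
    qed (rule convex_xset[OF cn nn])
  qed
  moreover have "0 \<le> max (g x) (h x)" if "x \<in> xset P n" for x using g(2)[OF that] by simp
  ultimately show ?thesis
    unfolding tame_def by (intro exI[of _ "\<lambda>x. max (g x) (h x)"]) simp
qed

text \<open>Two inductions are nested: one over the iterations and, within an iteration, one from
  the leaves upwards, since a cut of a child is computed from the child's already updated
  approximation.\<close>

lemma tame_iterate: "j \<le> i \<Longrightarrow> n \<in> nodes P \<Longrightarrow> tame j n"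
proof (induction j arbitrary: n)
  case 0
  then have "\<forall>x\<in>xset P n. lowQ R 0 n x = 0"
    using init xset_xspace unfolding initialization_def by blast
  then show ?case using tame_zero 0 by blast
next
  case (Suc j)
  have j: "Suc j \<in> {1..i}" using Suc.prems by simp
  from Suc.prems(2) show ?case
  proof (induction "horizon P - stage P n" arbitrary: n rule: less_induct)
    case less
    show ?case
    proof (cases "n \<in> nonleaves P")
      case True
      show ?thesis
      proof (rule tame_step[OF j True])
        show "tame j n" using Suc.IH Suc.prems(1) less.prems by simp
        fix m assume m: "m \<in> children P n"
        have "stage P n < horizon P" using nonleaf_iff[OF less.prems] True by blast
        then show "tame (Suc j) m"
          using less.hyps[of m] child_node[OF less.prems m] by simp
      qed
    next
      case False
      then show ?thesis using tame_zero[OF less.prems] leaf_zero(1)[OF less.prems] by blast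
    qed
  qed
qed

section \<open>Gap estimates within one iteration\<close>

lemma lowQ_real:
  assumes "j \<le> i" "n \<in> nodes P" "x \<in> xset P n"
  obtains q where "lowQ R j n x = ereal q" "0 \<le> q"
  using tame_iterate[OF assms(1,2)] assms(3) unfolding tame_def by blast

text \<open>The cut takes the value v at the iterate. Its linear part changes by at most
  \<open>lbnd\<close> times the distance by duality of norms, its penalty part by at most
  \<open>rbnd\<close> times the distance because the penalty is dominated by the norm.\<close>

lemma cut_ge:
  assumes j: "j \<in> {1..i}" and n: "n \<in> nodes P" and m: "m \<in> children P n"
    and x: "x \<in> xset P n" and v: "lowv R j m = ereal v"
  shows "ereal (v - (lbnd P m + rbnd P m) * nrm P n (x - xit R j n)) \<le> cut P R j m x"
proof -
  note ch = child_node[OF n m]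
  have mm: "m \<in> nodes P" using ch(1) by simp
  let ?xa = "xit R j n" and ?l = "lamit R j m" and ?\<rho> = "rhoit R j m"
  have xa: "?xa \<in> xset P n" by (rule iterate_xset[OF j n])
  note E = xspace_norm(1,2)[OF n] xset_xspace[OF n xa] xset_xspace[OF n x]
  have mult: "dual_norm (xspace P n) (nrm P n) ?l \<le> lbnd P m" "0 \<le> ?\<rho>" "?\<rho> \<le> rbnd P m"
    using multiplier_iterate(1)[OF j ch(1)] ch(2) unfolding multipliers_def by auto
  have "\<bar>?l \<bullet> (?xa - x)\<bar> \<le> lbnd P m * nrm P n (?xa - x)"
    using E by (intro dual_norm_inner_le[OF _ _ mult(1)]) (auto simp: subspace_diff)
  moreover have "?\<rho> * pen P m (?xa - x) \<le> rbnd P m * nrm P n (?xa - x)"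
    using pen_le[OF mm, of ?xa x] pen_nonneg[OF mm, of ?xa x] mult(2,3) ch(2) xa x
    by (intro mult_mono) auto
  moreover have "nrm P n (?xa - x) = nrm P n (x - ?xa)"
    using E by (intro norm_on_minus_commute)
  ultimately show ?thesis unfolding cut_real[OF v] ch(2) by (simp add: algebra_simps)
qed

text \<open>Let f be the regularized cost of the forward solution and q the old lower approximation
  there. Then f + q is the forward optimum, and it is at most v by strong duality, as the lower
  approximation has only grown. The upper value is f plus the new upper approximation, which has
  only shrunk, hence at most f + q + \<gamma>.\<close>

lemma upv_le:
  assumes j: "j \<in> {1..i}" and m: "m \<in> nodes P - {root P}"
    and gap: "upQ R (j - 1) m (xit R j m) \<le> lowQ R (j - 1) m (xit R j m) + ereal \<gamma>"
    and v: "lowv R j m = ereal v"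
  shows "upv R j m \<le> ereal (v + \<gamma>)"
proof -
  have mm: "m \<in> nodes P" using m by simp
  let ?xa = "xit R j (parent P m)"
  obtain k where k: "j = Suc k" "k \<le> i" using j by (cases j) auto
  have jj: "Suc k \<in> {1..i}" "Suc k \<le> i" using j k by auto
  have xa: "?xa \<in> xset P (parent P m)" using iterate_xset[OF j] parent_node[OF m] by blast
  note w = iterate_feas[OF j m]
  have xm: "xit R j m \<in> xset P m" using node_feasD(1)[OF mm w] .
  obtain q where q: "lowQ R k m (xit R j m) = ereal q" "0 \<le> q"
    using lowQ_real[OF k(2) mm xm] by blast
  define F where "F = (\<lambda>(x, y, z). reg_cost P m ?xa z y x + lowQ R k m x)"
  have min: "F (xit R j m, yit R j m, zit R j m) \<le> F w'" if "w' \<in> node_feas P m" for w'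
    using steps(1)[OF j] m that unfolding forward_step_def is_arg_min_linorder F_def k(1) diff_Suc_1 by blast
  obtain x y where xy: "\<forall>n\<in>nodes P. (x n, y n, x (parent P n)) \<in> node_feas P n"
      "\<forall>n\<in>nodes P. cost P n (x (parent P n)) (y n) (x n) < \<infinity>"
    by (rule feasible_point)
  obtain q' where q': "lowQ R k m (x m) = ereal q'"
    using lowQ_real[OF k(2) mm] node_feasD(1)[OF mm] xy(1) mm by metis
  \<comment> \<open>Comparison with the finite-cost feasible point shows that f is a real
    number.\<close>
  have "F (xit R j m, yit R j m, zit R j m) \<le> F (x m, y m, x (parent P m))"
    using min xy(1) mm by blast
  also have "\<dots> < \<infinity>" using xy(2) mm q' unfolding F_def reg_cost_def by auto
  finally have "reg_cost P m ?xa (zit R j m) (yit R j m) (xit R j m) < \<infinity>"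
    unfolding F_def using q by simp
  then obtain f where f: "reg_cost P m ?xa (zit R j m) (yit R j m) (xit R j m) = ereal f"
    using reg_cost_nonneg[OF mm w xa]
    by (cases "reg_cost P m ?xa (zit R j m) (yit R j m) (xit R j m)") auto
  have "ereal (f + q) \<le> lowv R j m"
  proof (rule lowv_ge[OF j m])
    show "tame j m" using tame_iterate jj k mm by simp
    fix x y z assume xyz: "(x, y, z) \<in> node_feas P m"
    have "ereal (f + q) \<le> reg_cost P m ?xa z y x + lowQ R k m x"
      using min[OF xyz] unfolding F_def by (simp add: f q)
    also have "\<dots> \<le> reg_cost P m ?xa z y x + lowQ R j m x"
      unfolding k(1) by (intro add_left_mono lowQ_Suc_ge[OF jj(1) mm] node_feasD(1)[OF mm xyz])
    finally show "ereal (f + q) \<le> reg_cost P m ?xa z y x + lowQ R j m x" .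
  qed
  then have fq: "f + q \<le> v" by (simp add: v)
  have "upv R j m = ereal f + upQ R j m (xit R j m)"
    using steps(3)[OF j] m f unfolding backward_step_def Let_def by simp
  also have "\<dots> \<le> ereal f + (ereal q + ereal \<gamma>)"
    using order.trans[OF upQ_Suc_le[OF jj(1) mm xm] gap[unfolded k(1) diff_Suc_1, folded k(1)]]
    unfolding q k(1)[symmetric] by (rule add_left_mono)
  also have "\<dots> \<le> ereal (v + \<gamma>)" using fq by simp
  finally show ?thesis .
qed

text \<open>At the iterate itself the gap is at most the average of the \<gamma> m. At distance r
  the cone adds at most \<open>lip_const\<close> times r, because \<open>sig\<close> is at most
  \<open>lbnd + rbnd\<close>, and the averaged cut loses at most as much.\<close>

lemma gap_near_iterate:
  assumes j: "j \<in> {1..i}" and n: "n \<in> nonleaves P" and x: "x \<in> xset P n"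
    and gap: "\<And>m. m \<in> children P n \<Longrightarrow>
      upQ R (j - 1) m (xit R j m) \<le> lowQ R (j - 1) m (xit R j m) + ereal (\<gamma> m)"
  shows "upQ R j n x \<le> lowQ R j n x + ereal ((\<Sum>m\<in>children P n. cprob P n m * \<gamma> m) +
           2 * lip_const P n * nrm P n (x - xit R j n))"
proof -
  have nn: "n \<in> nodes P" using nonleaves_nodes[OF n] .
  note ch = child_node[OF nn]
  obtain k where k: "j = Suc k" using j by (cases j) auto
  define r where "r = nrm P n (x - xit R j n)"
  have xE: "x \<in> xspace P n" by (rule xset_xspace[OF nn x])
  have "x - xit R j n \<in> xspace P n"
    using xE xset_xspace[OF nn iterate_xset[OF j nn]] xspace_norm(1)[OF nn] by (simp add: subspace_diff)
  then have r: "0 \<le> r" using xspace_norm(2)[OF nn] unfolding norm_on_def r_def by blast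
  define v where "v m = real_of_ereal (lowv R j m)" for m
  have v: "lowv R j m = ereal (v m)" if "m \<in> children P n" for m
    using lowv_real[OF j ch(1)[OF that] tame_iterate] j ch(1)[OF that] unfolding v_def
    by (metis Diff_iff atLeastAtMost_iff real_of_ereal.simps(1))
  have cp: "0 \<le> cprob P n m" if "m \<in> children P n" for m
    using cprob_pos[OF nn that] by simp
  have "upQ R j n x \<le> up_cone P R j n x"
    using upQ_Suc_le_min[of k n x] j n x unfolding k by simp
  also have "\<dots> \<le> (\<Sum>m\<in>children P n. ereal (cprob P n m * (v m + \<gamma> m + (lbnd P m + rbnd P m) * r)))"
    unfolding up_cone_def
  proof (rule sum_mono)
    fix m assume m: "m \<in> children P n"
    have "upv R j m + ereal (sig P m * nrm P n (x - xit R j n))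
        \<le> ereal (v m + \<gamma> m) + ereal ((lbnd P m + rbnd P m) * r)"
      using upv_le[OF j ch(1)[OF m] gap[OF m] v[OF m]] r bounds_nonneg(3)[OF ch(1)[OF m]]
      unfolding r_def by (intro add_mono) (auto intro: mult_right_mono)
    then have "ereal (cprob P n m) * (upv R j m + ereal (sig P m * nrm P n (x - xit R j n)))
        \<le> ereal (cprob P n m) * (ereal (v m + \<gamma> m) + ereal ((lbnd P m + rbnd P m) * r))"
      using cp[OF m] by (intro ereal_mult_left_mono) auto
    then show "ereal (cprob P n m) * (upv R j m + ereal (sig P m * nrm P n (x - xit R j n)))
        \<le> ereal (cprob P n m * (v m + \<gamma> m + (lbnd P m + rbnd P m) * r))"
      by simp
  qed
  \<comment> \<open>With l = \<open>lbnd + rbnd\<close>, each term v + \<gamma> + l r is split as (v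
    - l r) + \<gamma> + 2 l r; the first part is the lower bound for the cut.\<close>
  also have "\<dots> = ereal (\<Sum>m\<in>children P n. cprob P n m * (v m - (lbnd P m + rbnd P m) * r))
      + ereal ((\<Sum>m\<in>children P n. cprob P n m * \<gamma> m) + 2 * lip_const P n * r)"
    unfolding lip_const_def
    by (simp add: algebra_simps sum.distrib sum_subtractf sum_distrib_left sum_distrib_right)
  also have "\<dots> \<le> (\<Sum>m\<in>children P n. ereal (cprob P n m) * cut P R j m x)
      + ereal ((\<Sum>m\<in>children P n. cprob P n m * \<gamma> m) + 2 * lip_const P n * r)"
  proof (intro add_right_mono)
    have "(\<Sum>m\<in>children P n. ereal (cprob P n m) * ereal (v m - (lbnd P m + rbnd P m) * r))
        \<le> (\<Sum>m\<in>children P n. ereal (cprob P n m) * cut P R j m x)"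
      using cut_ge[OF j nn _ x v] cp unfolding r_def
      by (intro sum_mono ereal_mult_left_mono) auto
    then show "ereal (\<Sum>m\<in>children P n. cprob P n m * (v m - (lbnd P m + rbnd P m) * r))
        \<le> (\<Sum>m\<in>children P n. ereal (cprob P n m) * cut P R j m x)"
      by simp
  qed
  also have "\<dots> \<le> lowQ R j n x
      + ereal ((\<Sum>m\<in>children P n. cprob P n m * \<gamma> m) + 2 * lip_const P n * r)"
    using steps(2)[OF j] n xE unfolding update_step_def by (intro add_right_mono) simp
  finally show ?thesis unfolding r_def .
qed

text \<open>The stopping test failed before iteration j, and both bounds are evaluated at the same
  root iterate: \<open>LB\<close> equals its cost plus the lower approximation, \<open>UB\<close> is
  at most its cost plus the upper one. The common cost cancels once it is known to be
  finite.\<close>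

lemma root_gap:
  assumes j: "j \<in> {1..i}"
  shows "lowQ R (j - 1) (root P) (xit R j (root P)) + ereal \<epsilon> < upQ R (j - 1) (root P) (xit R j (root P))"
proof -
  let ?x = "xit R j (root P)" and ?y = "yit R j (root P)"
  have xr: "?x \<in> xset P (root P)" by (rule iterate_xset[OF j root_node])
  have jl: "j - 1 \<le> i" using j by auto
  obtain q where q: "lowQ R (j - 1) (root P) ?x = ereal q"
    using lowQ_real[OF jl root_node xr] by blast
  obtain x y where xy: "\<forall>n\<in>nodes P. (x n, y n, x (parent P n)) \<in> node_feas P n"
      "\<forall>n\<in>nodes P. cost P n (x (parent P n)) (y n) (x n) < \<infinity>"
    by (rule feasible_point)
  have fr: "(x (root P), y (root P), x (parent P (root P))) \<in> node_feas P (root P)"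
    using xy(1) root_node by blast
  then have x0: "x (parent P (root P)) = 0" by (simp add: node_feas_def xset_def)
  obtain q' where q': "lowQ R (j - 1) (root P) (x (root P)) = ereal q'"
    using lowQ_real[OF jl root_node node_feasD(1)[OF root_node fr]] by blast
  \<comment> \<open>Optimality of the iterate against the feasible point makes its cost finite,
    which extended-real cancellation requires.\<close>
  have "root_value P (lowQ R (j - 1) (root P)) (?x, ?y)
      \<le> root_value P (lowQ R (j - 1) (root P)) (x (root P), y (root P))"
    using root_iterate(1)[OF j] fr unfolding is_arg_min_linorder by (auto simp: node_feas_def)
  also have "\<dots> < \<infinity>"
    using xy(2) root_node x0 q' unfolding root_value_def by force
  finally have "cost P (root P) 0 ?y ?x < \<infinity>" unfolding root_value_def by (simp add: q)
  moreover have "(?x, ?y) \<in> feas P (root P)"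
    using root_iterate(1)[OF j] unfolding is_arg_min_def by blast
  then have "(?x, ?y, 0) \<in> node_feas P (root P)" by (simp add: node_feas_def xset_def)
  then have "0 \<le> cost P (root P) 0 ?y ?x" by (rule node_feasD(3)[OF root_node])
  ultimately obtain c where c: "cost P (root P) 0 ?y ?x = ereal c"
    by (cases "cost P (root P) 0 ?y ?x") auto
  have LB: "LB R (j - 1) = ereal (c + q)"
    unfolding root_iterate(2)[OF j] root_value_def prod.case c q by simp
  show ?thesis
  proof (cases "UB R (j - 1) = \<infinity> \<and> upQ R (j - 1) (root P) ?x = \<infinity>")
    case True
    then show ?thesis unfolding q by simp
  next
    case False
    then have "UB R (j - 1) \<le> ereal c + upQ R (j - 1) (root P) ?x"
      using root_iterate(3)[OF j] by (simp add: root_value_def c) blast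
    then have "ereal \<epsilon> < ereal c + upQ R (j - 1) (root P) ?x - ereal (c + q)"
      using steps(5)[OF j] unfolding LB by (meson ereal_minus_mono less_le_trans order_refl)
    then show ?thesis unfolding q by (cases "upQ R (j - 1) (root P) ?x") auto
  qed
qed

section \<open>Thresholds along the tree and separation of iterates\<close>

definition node_threshold :: "('n \<Rightarrow> real) \<Rightarrow> 'n \<Rightarrow> real" where
  "node_threshold \<delta> n = threshold P \<delta> (horizon P - stage P n) n"

lemma node_threshold_leaf:
  assumes "n \<in> nodes P" "n \<notin> nonleaves P"
  shows "node_threshold \<delta> n = 0"
  using nonleaf_iff[OF assms(1)] assms(2) unfolding node_threshold_def by simp

lemma node_threshold_nonleaf:
  assumes n: "n \<in> nonleaves P"
  shows "node_threshold \<delta> n = \<delta> n + (\<Sum>m\<in>children P n. cprob P n m * node_threshold \<delta> m)"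
proof -
  have nn: "n \<in> nodes P" using nonleaves_nodes[OF n] .
  obtain k where k: "horizon P - stage P n = Suc k"
    using nonleaf_iff[OF nn] n by (cases "horizon P - stage P n") auto
  have "horizon P - stage P m = k" if "m \<in> children P n" for m
    using child_node(3)[OF nn that] k by simp
  then show ?thesis unfolding node_threshold_def k by simp
qed

text \<open>Weighted by \<open>prob\<close>, the recursion telescopes: every node but the root is a
  child of exactly one nonleaf, \<open>prob P n * cprob P n m\<close> is \<open>prob P m\<close>,
  and leaves contribute 0. Only the root term remains.\<close>

lemma node_threshold_root:
  "node_threshold \<delta> (root P) = (\<Sum>n\<in>nonleaves P. prob P n * \<delta> n)"
proof -
  let ?t = "node_threshold \<delta>"
  have cover: "(\<Union>n\<in>nonleaves P. children P n) = nodes P - {root P}"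
  proof
    show "(\<Union>n\<in>nonleaves P. children P n) \<subseteq> nodes P - {root P}"
      using child_node(1) nonleaves_nodes by blast
    show "nodes P - {root P} \<subseteq> (\<Union>n\<in>nonleaves P. children P n)"
    proof
      fix m assume m: "m \<in> nodes P - {root P}"
      then have "m \<in> children P (parent P m)" unfolding children_def by simp
      moreover from this have "parent P m \<in> nonleaves P"
        using parent_node[OF m] unfolding nonleaves_def by blast
      ultimately show "m \<in> (\<Union>n\<in>nonleaves P. children P n)" by blast
    qed
  qed
  have "(\<Sum>n\<in>nonleaves P. prob P n * ?t n)
      = (\<Sum>n\<in>nonleaves P. prob P n * \<delta> n + (\<Sum>m\<in>children P n. prob P m * ?t m))"
  proof (rule sum.cong)
    fix n assume n: "n \<in> nonleaves P"
    have *: "prob P n * (cprob P n m * ?t m) = prob P m * ?t m" for m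
      using prob_pos[OF nonleaves_nodes[OF n]] unfolding cprob_def by simp
    then show "prob P n * ?t n = prob P n * \<delta> n + (\<Sum>m\<in>children P n. prob P m * ?t m)"
      unfolding node_threshold_nonleaf[OF n] by (simp only: distrib_left sum_distrib_left *)
  qed simp
  also have "\<dots> = (\<Sum>n\<in>nonleaves P. prob P n * \<delta> n)
      + (\<Sum>n\<in>nonleaves P. \<Sum>m\<in>children P n. prob P m * ?t m)"
    by (rule sum.distrib)
  also have "(\<Sum>n\<in>nonleaves P. \<Sum>m\<in>children P n. prob P m * ?t m)
      = (\<Sum>m\<in>nodes P - {root P}. prob P m * ?t m)"
    unfolding cover[symmetric]
    by (rule sum.UNION_disjoint[symmetric])
      (use finite_nonleaves finite_children in \<open>auto simp: children_def\<close>)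
  also have "\<dots> = (\<Sum>m\<in>nonleaves P - {root P}. prob P m * ?t m)"
    by (rule sum.mono_neutral_right)
      (use finite_nodes nonleaves_nodes node_threshold_leaf in auto)
  finally have "(\<Sum>n\<in>nonleaves P. prob P n * ?t n) - (\<Sum>m\<in>nonleaves P - {root P}. prob P m * ?t m)
      = (\<Sum>n\<in>nonleaves P. prob P n * \<delta> n)" by simp
  then show ?thesis
    using sum.remove[OF finite_nonleaves root_nonleaf, of "\<lambda>n. prob P n * ?t n"] prob_root by simp
qed

text \<open>The index j - 1 refers to the approximations from which the j-th iterate was computed,
  before the backward pass of iteration j changes them.\<close>

definition gap_above :: "('n \<Rightarrow> real) \<Rightarrow> nat \<Rightarrow> 'n \<Rightarrow> bool" where
  "gap_above \<gamma> j n \<longleftrightarrow> lowQ R (j - 1) n (xit R j n) + ereal (\<gamma> n) < upQ R (j - 1) n (xit R j n)"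

lemma exists_refined_node:
  assumes j: "j \<in> {1..i}" and \<delta>: "(\<Sum>n\<in>nonleaves P. prob P n * \<delta> n) = \<epsilon>"
  obtains n where "n \<in> nonleaves P" "gap_above (node_threshold \<delta>) j n"
    "\<forall>m\<in>children P n. \<not> gap_above (node_threshold \<delta>) j m"
proof -
  let ?S = "{n \<in> nodes P. gap_above (node_threshold \<delta>) j n}"
  have "root P \<in> ?S"
    using root_gap[OF j] root_node \<delta> node_threshold_root[of \<delta>] unfolding gap_above_def by simp
  then have S: "finite (stage P ` ?S)" "stage P ` ?S \<noteq> {}" using finite_nodes by auto
  obtain n where n: "n \<in> ?S" "stage P n = Max (stage P ` ?S)"
    using Max_in[OF S] by auto
  then have nn: "n \<in> nodes P" by simp
  show thesis
  proof (rule that)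
    show "gap_above (node_threshold \<delta>) j n" using n(1) by simp
    show "n \<in> nonleaves P"
    proof (rule ccontr)
      assume "n \<notin> nonleaves P"
      then show False
        using n(1) leaf_zero[OF nn _ iterate_xset[OF j nn]] node_threshold_leaf[OF nn]
        unfolding gap_above_def by simp
    qed
    show "\<forall>m\<in>children P n. \<not> gap_above (node_threshold \<delta>) j m"
    proof (intro ballI notI)
      fix m assume m: "m \<in> children P n"
      assume "gap_above (node_threshold \<delta>) j m"
      then have "m \<in> ?S" using child_node(1)[OF nn m] by simp
      then have "stage P m \<le> stage P n" unfolding n(2) using S(1) by (intro Max_ge) auto
      then show False using child_node(3)[OF nn m] by simp
    qed
  qed
qed

text \<open>Small gaps at the children in iteration j bound the gap of n near its j-th iterate, and
  by monotonicity this bound still holds for the approximations of index k - 1. A large gap at the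
  k-th iterate therefore forces distance; \<delta> n is what the threshold of n exceeds the average
  of its children's thresholds by.\<close>

lemma iterates_separated:
  assumes j: "j \<in> {1..i}" and k: "k \<in> {1..i}" "j < k" and n: "n \<in> nonleaves P"
    and small: "\<And>m. m \<in> children P n \<Longrightarrow> \<not> gap_above (node_threshold \<delta>) j m"
    and large: "gap_above (node_threshold \<delta>) k n"
  shows "\<delta> n < 2 * lip_const P n * nrm P n (xit R k n - xit R j n)"
proof -
  have nn: "n \<in> nodes P" using nonleaves_nodes[OF n] .
  let ?x = "xit R k n" and ?t = "node_threshold \<delta>"
  have x: "?x \<in> xset P n" by (rule iterate_xset[OF k(1) nn])
  have le: "j \<le> k - 1" "k - 1 \<le> i" using k by auto
  obtain q where q: "lowQ R (k - 1) n ?x = ereal q" using lowQ_real[OF le(2) nn x] by blast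
  have "ereal (q + ?t n) < upQ R (k - 1) n ?x"
    using large unfolding gap_above_def q by simp
  also have "\<dots> \<le> upQ R j n ?x" by (rule upQ_antimono[OF le nn x])
  also have "\<dots> \<le> lowQ R j n ?x + ereal ((\<Sum>m\<in>children P n. cprob P n m * ?t m) +
           2 * lip_const P n * nrm P n (?x - xit R j n))"
    using small unfolding gap_above_def not_less by (rule gap_near_iterate[OF j n x])
  also have "\<dots> \<le> ereal q + ereal ((\<Sum>m\<in>children P n. cprob P n m * ?t m) +
           2 * lip_const P n * nrm P n (?x - xit R j n))"
    using lowQ_mono[OF le nn x] unfolding q by (rule add_right_mono)
  finally show ?thesis unfolding node_threshold_nonleaf[OF n] by simp
qed

section \<open>Counting the iterations\<close>

lemma lip_const_pos:
  assumes n: "n \<in> nonleaves P"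
  shows "0 < lip_const P n"
  unfolding lip_const_def
proof (rule sum_pos)
  have nn: "n \<in> nodes P" using nonleaves_nodes[OF n] .
  show "children P n \<noteq> {}" using n unfolding nonleaves_def by simp
  fix m assume m: "m \<in> children P n"
  have "0 < lbnd P m + rbnd P m"
    using bounds_nonneg(3)[OF child_node(1)[OF nn m]] sig_pos child_node(1)[OF nn m] by fastforce
  then show "0 < cprob P n m * (lbnd P m + rbnd P m)" using cprob_pos[OF nn m] by simp
qed (rule finite_children)

lemma card_separated_iterates:
  fixes K :: nat
  assumes n: "n \<in> nonleaves P" and \<delta>: "0 < \<delta>"
    and J: "finite J" "J \<subseteq> {1..i}"
    and sep: "\<And>j k. j \<in> J \<Longrightarrow> k \<in> J \<Longrightarrow> j < k \<Longrightarrow>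
      \<delta> < 2 * lip_const P n * nrm P n (xit R k n - xit R j n)"
    and ball: "\<And>k. k \<in> {1..K} \<Longrightarrow> 0 \<le> D k \<and> is_ball (xspace P n) (nrm P n) (D k) (B k)"
    and cover: "xset P n \<subseteq> (\<Union>k\<in>{1..K}. B k)"
  shows "real (card J) \<le> (\<Sum>k = 1..K. (1 + 2 * lip_const P n * D k / \<delta>) ^ dim (xspace P n))"
proof -
  have nn: "n \<in> nodes P" using nonleaves_nodes[OF n] .
  note sub = xspace_norm(1)[OF nn] and \<nu> = xspace_norm(2)[OF nn]
  let ?L = "lip_const P n" and ?X = "(\<lambda>j. xit R j n) ` J"
  have L: "0 < ?L" by (rule lip_const_pos[OF n])
  have Xset: "?X \<subseteq> xset P n" using iterate_xset[OF _ nn] J by blast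
  have XE: "?X \<subseteq> xspace P n" using Xset xset_xspace[OF nn] by blast
  \<comment> \<open>The separation is known for the later iterate relative to the earlier one;
    symmetry of the norm removes the order.\<close>
  have far: "\<delta> < 2 * ?L * nrm P n (xit R k n - xit R j n)" if "j \<in> J" "k \<in> J" "j \<noteq> k" for j k
  proof (cases "j < k")
    case True
    then show ?thesis using sep that by blast
  next
    case False
    then have "\<delta> < 2 * ?L * nrm P n (xit R j n - xit R k n)" using sep[of k j] that by simp
    then show ?thesis using norm_on_minus_commute[OF sub \<nu>] XE that by (metis imageI subsetD)
  qed
  \<comment> \<open>Coinciding iterates would have distance 0, contrary to \<delta> > 0, so counting
    iterations amounts to counting points.\<close>
  have "inj_on (\<lambda>j. xit R j n) J"
  proof (rule inj_onI)
    fix j k assume jk: "j \<in> J" "k \<in> J" "xit R j n = xit R k n"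
    show "j = k"
    proof (rule ccontr)
      assume "j \<noteq> k"
      then show False using far[OF jk(1,2)] jk(3) norm_on_zero[OF sub \<nu>] \<delta> by simp
    qed
  qed
  then have "card J = card ?X" by (rule card_image[symmetric])
  also have "?X = (\<Union>k\<in>{1..K}. ?X \<inter> B k)" using Xset cover by blast
  also have "card (\<Union>k\<in>{1..K}. ?X \<inter> B k) \<le> (\<Sum>k = 1..K. card (?X \<inter> B k))"
    by (rule card_UN_le) simp
  finally have "real (card J) \<le> (\<Sum>k = 1..K. real (card (?X \<inter> B k)))"
    by (metis of_nat_mono of_nat_sum)
  also have "\<dots> \<le> (\<Sum>k = 1..K. (1 + 2 * ?L * D k / \<delta>) ^ dim (xspace P n))"
  proof (rule sum_mono)
    fix k assume k: "k \<in> {1..K}"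
    obtain c where c: "c \<in> xspace P n" "\<And>x. x \<in> B k \<Longrightarrow> nrm P n (x - c) \<le> D k / 2"
      using ball[OF k] unfolding is_ball_def by fastforce
    \<comment> \<open>Radius \<open>D k / 2\<close> and separation
      \<open>\<delta> / (2 * ?L)\<close> enter the packing bound.\<close>
    have "real (card (?X \<inter> B k)) \<le> (1 + 2 * (D k / 2) / (\<delta> / (2 * ?L))) ^ dim (xspace P n)"
    proof (rule packing_bound[OF sub \<nu> _ _ c(1)])
      show "finite (?X \<inter> B k)" "?X \<inter> B k \<subseteq> xspace P n" using J(1) XE by auto
      show "0 \<le> D k / 2" using ball[OF k] by simp
      show "0 < \<delta> / (2 * ?L)" using \<delta> L by simp
    next
      fix x y assume "x \<in> ?X \<inter> B k" "y \<in> ?X \<inter> B k" "x \<noteq> y"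
      then show "\<delta> / (2 * ?L) \<le> nrm P n (x - y)"
        using far L by (force simp: pos_divide_le_eq mult.commute)
    qed (use c(2) in blast)
    also have "1 + 2 * (D k / 2) / (\<delta> / (2 * ?L)) = 1 + 2 * ?L * D k / \<delta>" by simp
    finally show "real (card (?X \<inter> B k)) \<le> (1 + 2 * ?L * D k / \<delta>) ^ dim (xspace P n)" .
  qed
  finally show ?thesis .
qed

theorem iteration_bound:
  fixes \<delta> :: "'n \<Rightarrow> real" and K :: "'n \<Rightarrow> nat"
  assumes "\<And>n. n \<in> nonleaves P \<Longrightarrow> \<delta> n > 0"
    and "(\<Sum>n\<in>nonleaves P. prob P n * \<delta> n) = \<epsilon>"
    and "\<And>n k. n \<in> nodes P \<Longrightarrow> k \<in> {1..K n} \<Longrightarrow>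
           D n k \<ge> 0 \<and> is_ball (xspace P n) (nrm P n) (D n k) (B n k)"
    and "\<And>n. n \<in> nodes P \<Longrightarrow> xset P n \<subseteq> (\<Union>k\<in>{1..K n}. B n k)"
  shows "real i \<le> (\<Sum>n\<in>nonleaves P. \<Sum>k = 1..K n.
           (1 + 2 * lip_const P n * D n k / \<delta> n) ^ dim (xspace P n))"
proof -
  \<comment> \<open>The iterations that refine n. One iteration may belong to several nodes, so the
    sets cover without being disjoint and a union bound is used.\<close>
  define J where "J n = {j \<in> {1..i}. gap_above (node_threshold \<delta>) j n \<and>
      (\<forall>m\<in>children P n. \<not> gap_above (node_threshold \<delta>) j m)}" for n
  have fin: "finite (J n)" for n unfolding J_def by simp
  have "{1..i} \<subseteq> (\<Union>n\<in>nonleaves P. J n)"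
  proof
    fix j assume j: "j \<in> {1..i}"
    obtain n where "n \<in> nonleaves P" "gap_above (node_threshold \<delta>) j n"
        "\<forall>m\<in>children P n. \<not> gap_above (node_threshold \<delta>) j m"
      using exists_refined_node[OF j assms(2)] .
    then show "j \<in> (\<Union>n\<in>nonleaves P. J n)" using j unfolding J_def by blast
  qed
  then have "card {1..i} \<le> card (\<Union>n\<in>nonleaves P. J n)"
    using fin finite_nonleaves by (intro card_mono) auto
  also have "\<dots> \<le> (\<Sum>n\<in>nonleaves P. card (J n))" by (rule card_UN_le[OF finite_nonleaves])
  finally have "real i \<le> (\<Sum>n\<in>nonleaves P. real (card (J n)))"
    by (simp flip: of_nat_sum)
  also have "\<dots> \<le> (\<Sum>n\<in>nonleaves P. \<Sum>k = 1..K n.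
           (1 + 2 * lip_const P n * D n k / \<delta> n) ^ dim (xspace P n))"
  proof (rule sum_mono)
    fix n assume n: "n \<in> nonleaves P"
    show "real (card (J n)) \<le>
        (\<Sum>k = 1..K n. (1 + 2 * lip_const P n * D n k / \<delta> n) ^ dim (xspace P n))"
    proof (rule card_separated_iterates[OF n assms(1)[OF n] fin])
      show "J n \<subseteq> {1..i}" unfolding J_def by blast
      show "xset P n \<subseteq> (\<Union>k\<in>{1..K n}. B n k)" using assms(4) nonleaves_nodes[OF n] by blast
      fix j k assume "j \<in> J n" "k \<in> J n" "j < k"
      then show "\<delta> n < 2 * lip_const P n * nrm P n (xit R k n - xit R j n)"
        unfolding J_def by (intro iterates_separated n) auto
    qed (use assms(3) nonleaves_nodes[OF n] in blast)
  qed
  finally show ?thesis .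
qed

end

theorem theorem1:
  fixes P :: "('n, 'a::euclidean_space, 'b::euclidean_space) problem"
    and R :: "('n, 'a, 'b) run"
    and \<epsilon> :: real and \<delta> :: "'n \<Rightarrow> real"
    and K :: "'n \<Rightarrow> nat" and B :: "'n \<Rightarrow> nat \<Rightarrow> 'a set" and D :: "'n \<Rightarrow> nat \<Rightarrow> real"
    and i :: nat
  assumes "scenario_tree P" and "regular_data P" and "regularization P"
    and "exact_regularization P" and "multiplier_bounds P"
    and "\<epsilon> > 0"
    and "\<And>n. n \<in> nonleaves P \<Longrightarrow> \<delta> n > 0"
    and "(\<Sum>n\<in>nonleaves P. prob P n * \<delta> n) = \<epsilon>"
    and "\<And>n k. n \<in> nodes P \<Longrightarrow> k \<in> {1..K n} \<Longrightarrow>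
           D n k \<ge> 0 \<and> is_ball (xspace P n) (nrm P n) (D n k) (B n k)"
    and "\<And>n. n \<in> nodes P \<Longrightarrow> xset P n \<subseteq> (\<Union>k\<in>{1..K n}. B n k)"
    and "terminates_at P \<epsilon> R i"
    and "eps_optimal_root P \<epsilon> (incumbent R i)"
  shows "real i \<le> (\<Sum>n\<in>nonleaves P. \<Sum>k = 1..K n.
           (1 + 2 * lip_const P n * D n k / \<delta> n) ^ dim (xspace P n))"
proof -
  have "nested_decomposition P R \<epsilon> i"
    using assms(1-3,5,11) by (rule nested_decomposition.intro)
  then show ?thesis
    using assms(7-10) by (rule nested_decomposition.iteration_bound)
qed

end
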